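(* Let $(M, g, X, \rho)$ be a compact almost Yamabe soliton of dimension $n \geq 2$ without boundary. If the scalar curvature $R$ of the Riemannian metric $g$ satisfies either $0 \leq \rho \leq R$ on $M$, or $R \leq \rho \leq 0$ on $M$, then $X$ is a Killing vector field.
   Context: An almost Yamabe soliton $(M, g, X, \rho)$ consists of a Riemannian manifold $(M, g)$, a smooth vector field $X$ on $M$, and a smooth function $\rho : M \to \mathbb{R}$ such that $$\tfrac{1}{2} \mathcal{L}_X g = (R - \rho) g,$$ where $\mathcal{L}_X$ is the Lie derivative along $X$ and $R$ is the scalar curvature of $g$. It is called compact if $M$ is compact. A vector field $X$ is Killing if $\mathcal{L}_X g = 0$. *)

theory Defs
  imports "HOL-Analysis.Analysis"
begin

section \<open>Smooth maps on open subsets of Euclidean space\<close>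

definition pd :: "'n \<Rightarrow> (real^'n \<Rightarrow> 'b) \<Rightarrow> real^'n \<Rightarrow> 'b::real_normed_vector"
  where "pd i f x = frechet_derivative f (at x) (axis i 1)"

text \<open>Both predicates are meant for open \<open>S\<close>; then \<open>C\<^sup>k\<close> says that all partial
  derivatives up to order \<open>k\<close> exist and are continuous.\<close>

primrec Ck_on :: "nat \<Rightarrow> (real^'n) set \<Rightarrow> (real^'n \<Rightarrow> 'b::real_normed_vector) \<Rightarrow> bool"
  where
    "Ck_on 0 S f \<longleftrightarrow> continuous_on S f"
  | "Ck_on (Suc k) S f \<longleftrightarrow> (\<forall>x\<in>S. f differentiable (at x)) \<and> (\<forall>i. Ck_on k S (pd i f))"

definition smooth_on :: "(real^'n) set \<Rightarrow> (real^'n \<Rightarrow> 'b::real_normed_vector) \<Rightarrow> bool"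
  where "smooth_on S f \<longleftrightarrow> (\<forall>k. Ck_on k S f)"

section \<open>Smooth manifolds\<close>

text \<open>A chart is a pair of a domain and a coordinate map. Coordinate ranges are open in
  \<open>real^'n\<close>, so manifolds have no boundary, and their dimension is \<open>CARD('n)\<close>.\<close>

type_synonym ('a, 'n) chart = "'a set \<times> ('a \<Rightarrow> real^'n)"

definition chart_dom :: "('a, 'n) chart \<Rightarrow> 'a set"
  where "chart_dom c = fst c"

definition coord :: "('a, 'n) chart \<Rightarrow> 'a \<Rightarrow> real^'n"
  where "coord c = snd c"

definition chart_ran :: "('a, 'n) chart \<Rightarrow> (real^'n) set"
  where "chart_ran c = coord c ` chart_dom c"

definition param :: "('a, 'n) chart \<Rightarrow> real^'n \<Rightarrow> 'a"
  where "param c = inv_into (chart_dom c) (coord c)"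

definition is_chart :: "'a topology \<Rightarrow> ('a, 'n::finite) chart \<Rightarrow> bool"
  where "is_chart M c \<longleftrightarrow>
    openin M (chart_dom c) \<and> open (chart_ran c) \<and>
    homeomorphic_map (subtopology M (chart_dom c)) (top_of_set (chart_ran c)) (coord c)"

definition overlap :: "('a, 'n) chart \<Rightarrow> ('a, 'n) chart \<Rightarrow> (real^'n) set"
  where "overlap c d = coord c ` (chart_dom c \<inter> chart_dom d)"

definition transition :: "('a, 'n) chart \<Rightarrow> ('a, 'n) chart \<Rightarrow> real^'n \<Rightarrow> real^'n"
  where "transition c d = coord d \<circ> param c"

definition smooth_manifold :: "'a topology \<Rightarrow> ('a, 'n::finite) chart set \<Rightarrow> bool"
  where "smooth_manifold M A \<longleftrightarrow>
    Hausdorff_space M \<and> second_countable M \<and>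
    (\<forall>c\<in>A. is_chart M c) \<and> (\<Union>c\<in>A. chart_dom c) = topspace M \<and>
    (\<forall>c\<in>A. \<forall>d\<in>A. smooth_on (overlap c d) (transition c d))"

section \<open>Functions, vector fields and metrics\<close>

definition smooth_function :: "('a, 'n::finite) chart set \<Rightarrow> ('a \<Rightarrow> real) \<Rightarrow> bool"
  where "smooth_function A f \<longleftrightarrow> (\<forall>c\<in>A. smooth_on (chart_ran c) (f \<circ> param c))"

text \<open>Tensor fields are given by their components in every chart of the atlas, subject to
  the transformation law under change of charts. The vector field with components \<open>X\<close> is
  \<open>\<Sum>i. X c x $ i *\<^sub>R \<partial>\<^sub>i\<close> in the chart \<open>c\<close>, and the metric with components \<open>g\<close> has
  \<open>g c x $ i $ j = g(\<partial>\<^sub>i, \<partial>\<^sub>j)\<close>; in both cases \<open>x\<close> is a point of the coordinate range of \<open>c\<close>,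
  and values outside that range carry no meaning.\<close>

type_synonym ('a, 'n) vfield = "('a, 'n) chart \<Rightarrow> real^'n \<Rightarrow> real^'n"
type_synonym ('a, 'n) tensor2 = "('a, 'n) chart \<Rightarrow> real^'n \<Rightarrow> real^'n^'n"

definition smooth_vector_field :: "('a, 'n::finite) chart set \<Rightarrow> ('a, 'n) vfield \<Rightarrow> bool"
  where "smooth_vector_field A X \<longleftrightarrow>
    (\<forall>c\<in>A. smooth_on (chart_ran c) (X c)) \<and>
    (\<forall>c\<in>A. \<forall>d\<in>A. \<forall>x\<in>overlap c d.
       X d (transition c d x) = jacobian (transition c d) (at x) *v X c x)"

definition riemannian_metric :: "('a, 'n::finite) chart set \<Rightarrow> ('a, 'n) tensor2 \<Rightarrow> bool"
  where "riemannian_metric A g \<longleftrightarrow>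
    (\<forall>c\<in>A. smooth_on (chart_ran c) (g c)) \<and>
    (\<forall>c\<in>A. \<forall>x\<in>chart_ran c. transpose (g c x) = g c x \<and> (\<forall>v. v \<noteq> 0 \<longrightarrow> v \<bullet> (g c x *v v) > 0)) \<and>
    (\<forall>c\<in>A. \<forall>d\<in>A. \<forall>x\<in>overlap c d.
       g c x = transpose (jacobian (transition c d) (at x)) ** g d (transition c d x)
               ** jacobian (transition c d) (at x))"

definition riemannian_manifold ::
    "'a topology \<Rightarrow> ('a, 'n::finite) chart set \<Rightarrow> ('a, 'n) tensor2 \<Rightarrow> bool"
  where "riemannian_manifold M A g \<longleftrightarrow> smooth_manifold M A \<and> riemannian_metric A g"

section \<open>Scalar curvature\<close>

text \<open>In this section \<open>h\<close> is the matrix of metric components in a single chart.\<close>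

definition christoffel ::
    "(real^'n \<Rightarrow> real^'n^'n) \<Rightarrow> 'n::finite \<Rightarrow> 'n \<Rightarrow> 'n \<Rightarrow> real^'n \<Rightarrow> real"
  where "christoffel h k i j x =
    1/2 * (\<Sum>l\<in>UNIV. matrix_inv (h x) $ k $ l *
      (pd i (\<lambda>y. h y $ j $ l) x + pd j (\<lambda>y. h y $ i $ l) x - pd l (\<lambda>y. h y $ i $ j) x))"

text \<open>\<open>riemann h l i j k\<close> is the \<open>\<partial>\<^sub>l\<close> component of \<open>R(\<partial>\<^sub>i, \<partial>\<^sub>j) \<partial>\<^sub>k\<close>, where
  \<open>R(X, Y) Z = \<nabla>\<^sub>X \<nabla>\<^sub>Y Z - \<nabla>\<^sub>Y \<nabla>\<^sub>X Z - \<nabla>\<^bsub>[X, Y]\<^esub> Z\<close>, and \<open>Ric(Y, Z)\<close> is the trace of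
  \<open>X \<mapsto> R(X, Y) Z\<close>. Thus round spheres have positive scalar curvature.\<close>

definition riemann ::
    "(real^'n \<Rightarrow> real^'n^'n) \<Rightarrow> 'n::finite \<Rightarrow> 'n \<Rightarrow> 'n \<Rightarrow> 'n \<Rightarrow> real^'n \<Rightarrow> real"
  where "riemann h l i j k x =
    pd i (christoffel h l j k) x - pd j (christoffel h l i k) x +
    (\<Sum>m\<in>UNIV. christoffel h l i m x * christoffel h m j k x -
               christoffel h l j m x * christoffel h m i k x)"

definition ricci :: "(real^'n \<Rightarrow> real^'n^'n) \<Rightarrow> 'n::finite \<Rightarrow> 'n \<Rightarrow> real^'n \<Rightarrow> real"
  where "ricci h j k x = (\<Sum>i\<in>UNIV. riemann h i i j k x)"

definition scalar_curvature_coord :: "(real^'n \<Rightarrow> real^'n^'n) \<Rightarrow> real^'n::finite \<Rightarrow> real"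
  where "scalar_curvature_coord h x =
    (\<Sum>j\<in>UNIV. \<Sum>k\<in>UNIV. matrix_inv (h x) $ j $ k * ricci h j k x)"

text \<open>For a Riemannian metric the value does not depend on the chart around \<open>p\<close>.\<close>

definition scalar_curvature ::
    "('a, 'n::finite) chart set \<Rightarrow> ('a, 'n) tensor2 \<Rightarrow> 'a \<Rightarrow> real"
  where "scalar_curvature A g p =
    (let c = (SOME c. c \<in> A \<and> p \<in> chart_dom c) in scalar_curvature_coord (g c) (coord c p))"

section \<open>Lie derivative, Killing fields and almost Yamabe solitons\<close>

text \<open>The components of the Lie derivative of \<open>g\<close> along \<open>X\<close>, that is
  \<open>(L\<^sub>X g)(\<partial>\<^sub>i, \<partial>\<^sub>j) = X(g(\<partial>\<^sub>i, \<partial>\<^sub>j)) - g([X, \<partial>\<^sub>i], \<partial>\<^sub>j) - g(\<partial>\<^sub>i, [X, \<partial>\<^sub>j])\<close>,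
  using \<open>[X, \<partial>\<^sub>i] = - (\<Sum>k. \<partial>\<^sub>i X\<^sup>k *\<^sub>R \<partial>\<^sub>k)\<close>.\<close>

definition lie_derivative :: "('a, 'n::finite) vfield \<Rightarrow> ('a, 'n) tensor2 \<Rightarrow> ('a, 'n) tensor2"
  where "lie_derivative X g c x =
    (\<chi> i j. \<Sum>k\<in>UNIV. X c x $ k * pd k (\<lambda>y. g c y $ i $ j) x
                    + pd i (\<lambda>y. X c y $ k) x * g c x $ k $ j
                    + pd j (\<lambda>y. X c y $ k) x * g c x $ i $ k)"

definition killing_vector_field ::
    "('a, 'n::finite) chart set \<Rightarrow> ('a, 'n) tensor2 \<Rightarrow> ('a, 'n) vfield \<Rightarrow> bool"
  where "killing_vector_field A g X \<longleftrightarrow>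
    smooth_vector_field A X \<and> (\<forall>c\<in>A. \<forall>x\<in>chart_ran c. lie_derivative X g c x = 0)"

definition almost_yamabe_soliton ::
    "'a topology \<Rightarrow> ('a, 'n::finite) chart set \<Rightarrow> ('a, 'n) tensor2 \<Rightarrow> ('a, 'n) vfield
      \<Rightarrow> ('a \<Rightarrow> real) \<Rightarrow> bool"
  where "almost_yamabe_soliton M A g X \<rho> \<longleftrightarrow>
    riemannian_manifold M A g \<and> smooth_vector_field A X \<and> smooth_function A \<rho> \<and>
    (\<forall>c\<in>A. \<forall>x\<in>chart_ran c.
       (1/2) *\<^sub>R lie_derivative X g c x =
       (scalar_curvature A g (param c x) - \<rho> (param c x)) *\<^sub>R g c x)"

end

theory Submission
  imports Defs
begin

text \<open>Taking the trace of the soliton equation gives \<open>div X = n (R - \<rho>)\<close>, which has a constant sign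
  under either hypothesis, while its integral over \<open>M\<close> vanishes by the divergence theorem. Hence
  \<open>R = \<rho>\<close>, and the soliton equation becomes the Killing equation.

  \<open>M\<close> need not be orientable, so the integral is that of the Riemannian density. It is expressed
  through a \<open>C\<^sup>1\<close> partition of unity \<open>\<psi>\<close>: integrating by parts in the charts gives
  \<open>\<integral> div X = - (\<Sum>p. \<integral> X \<psi>\<^sub>p) = - (\<Sum>p q. \<integral> \<psi>\<^sub>q X \<psi>\<^sub>p) = - (\<Sum>q. \<integral> \<psi>\<^sub>q X 1) = 0\<close>, where the
  third equality moves each integral from the chart of \<open>p\<close> to the chart of \<open>q\<close>.\<close>

section \<open>Continuously differentiable functions\<close>

text \<open>Integration by parts consumes a single derivative, so cutoffs of class C^1 are enough.
  This permits a bump made from the squared positive part of a quadratic polynomial, and the smooth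
  data enter only through \<open>C1_on\<close>. The function \<open>R - \<rho>\<close> is carried
  along as an opaque function \<open>f\<close> on points. Its continuity, which the last step needs,
  is read off from the identity that makes \<open>n * f\<close> the divergence of \<open>X\<close>:
  the other side is an expression in first derivatives of C^1 functions. No measure on
  \<open>M\<close> is built; every integral lives in one chart. Two charts can be compared only for
  a function that vanishes off their overlap. This is why a second partition function is inserted:
  \<open>\<psi>\<^sub>q * X \<psi>\<^sub>p\<close> lives in both charts, because
  \<open>X \<psi>\<^sub>p\<close> vanishes wherever \<open>\<psi>\<^sub>p\<close> does, a zero of a
  nonnegative function being a minimum.\<close>

definition C1_on :: "'a::real_normed_vector set \<Rightarrow> ('a \<Rightarrow> 'b::real_normed_vector) \<Rightarrow> bool"
  where "C1_on S f \<longleftrightarrow>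
    (\<exists>f'. (\<forall>x\<in>S. (f has_derivative blinfun_apply (f' x)) (at x)) \<and> continuous_on S f')"

lemma C1_onI:
  assumes "\<And>x. x \<in> S \<Longrightarrow> (f has_derivative blinfun_apply (f' x)) (at x)" "continuous_on S f'"
  shows "C1_on S f"
  using assms unfolding C1_on_def by blast

lemma C1_onE:
  assumes "C1_on S f"
  obtains f' where "\<And>x. x \<in> S \<Longrightarrow> (f has_derivative blinfun_apply (f' x)) (at x)"
    "continuous_on S f'"
  using assms unfolding C1_on_def by blast

lemma C1_on_has_frechet_derivative:
  assumes "C1_on S f" "x \<in> S"
  shows "(f has_derivative frechet_derivative f (at x)) (at x)"
  by (metis C1_onE assms frechet_derivative_at)

lemma C1_on_imp_continuous_on: "C1_on S f \<Longrightarrow> continuous_on S f"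
  by (meson C1_onE has_derivative_at_withinI has_derivative_continuous_on)

lemma C1_on_cong_open:
  assumes "C1_on S f" "open S" "\<And>x. x \<in> S \<Longrightarrow> f x = g x"
  shows "C1_on S g"
proof -
  obtain f' where f': "\<And>x. x \<in> S \<Longrightarrow> (f has_derivative blinfun_apply (f' x)) (at x)"
    "continuous_on S f'"
    using assms(1) by (rule C1_onE) blast
  show ?thesis
    by (rule C1_onI[OF has_derivative_transform_within_open[OF f'(1)] f'(2)])
      (use assms in auto)
qed

lemma continuous_on_frechet_derivative:
  assumes f: "C1_on S f" and v: "continuous_on S v"
  shows "continuous_on S (\<lambda>x. frechet_derivative f (at x) (v x))"
proof -
  obtain f' where f': "\<And>x. x \<in> S \<Longrightarrow> (f has_derivative blinfun_apply (f' x)) (at x)"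
    "continuous_on S f'"
    using f by (rule C1_onE) blast
  have "continuous_on S (\<lambda>x. blinfun_apply (f' x) (v x))"
    using f'(2) v by (intro continuous_intros)
  then show ?thesis
    by (rule continuous_on_eq) (use f'(1) frechet_derivative_at in force)
qed

text \<open>Each neighbourhood brings its own witness for the derivative. Uniqueness of derivatives
  makes all of them agree with the one candidate \<open>f'\<close>. This serves functions defined by
  cases, such as extensions by zero.\<close>

lemma C1_on_local:
  assumes "\<And>x. x \<in> S \<Longrightarrow> \<exists>U. open U \<and> x \<in> U \<and> C1_on U f"
  shows "C1_on S f"
proof -
  define f' where "f' x = Blinfun (frechet_derivative f (at x))" for x
  have *: "\<exists>U. open U \<and> x \<in> U \<and> (\<forall>y\<in>U. (f has_derivative blinfun_apply (f' y)) (at y))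
      \<and> continuous_on U f'" if x: "x \<in> S" for x
  proof -
    obtain U F where U: "open U" "x \<in> U"
      and F: "\<And>y. y \<in> U \<Longrightarrow> (f has_derivative blinfun_apply (F y)) (at y)" "continuous_on U F"
      using assms[OF x] unfolding C1_on_def by blast
    have "F y = f' y" if "y \<in> U" for y
      unfolding f'_def using frechet_derivative_at[OF F(1)[OF that]]
      by (metis blinfun_apply_inverse)
    then show ?thesis
      using U F by (metis continuous_on_eq)
  qed
  show ?thesis
  proof (rule C1_onI)
    show "(f has_derivative blinfun_apply (f' x)) (at x)" if "x \<in> S" for x
      using *[OF that] by blast
    show "continuous_on S f'"
      by (meson * continuous_at_imp_continuous_on continuous_on_eq_continuous_at)
  qed
qed

lemma C1_on_const [intro]: "C1_on S (\<lambda>_. c)"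
  by (rule C1_onI[where f' = "\<lambda>_. 0"]) (auto intro!: derivative_eq_intros continuous_intros)

lemma C1_on_bounded_linear:
  assumes "bounded_linear f"
  shows "C1_on S f"
  by (rule C1_onI[where f' = "\<lambda>_. Blinfun f"])
    (auto simp: bounded_linear_Blinfun_apply assms bounded_linear_imp_has_derivative)

lemma C1_on_compose:
  assumes f: "C1_on T f" and g: "C1_on S g" and "g ` S \<subseteq> T"
  shows "C1_on S (\<lambda>x. f (g x))"
proof -
  obtain f' where f': "\<And>x. x \<in> T \<Longrightarrow> (f has_derivative blinfun_apply (f' x)) (at x)"
    "continuous_on T f'"
    using f by (rule C1_onE) blast
  obtain g' where g': "\<And>x. x \<in> S \<Longrightarrow> (g has_derivative blinfun_apply (g' x)) (at x)"
    "continuous_on S g'"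
    using g by (rule C1_onE) blast
  show ?thesis
  proof (rule C1_onI)
    fix x assume "x \<in> S"
    then show "((\<lambda>x. f (g x)) has_derivative blinfun_apply (f' (g x) o\<^sub>L g' x)) (at x)"
      using has_derivative_compose[OF g'(1)[of x] f'(1)[of "g x"]] assms(3)
      by (auto simp: blinfun_apply_blinfun_compose[abs_def] o_def)
  next
    have "continuous_on S (\<lambda>x. f' (g x))"
      using continuous_on_compose2[OF f'(2) C1_on_imp_continuous_on[OF g]] assms(3) by blast
    then show "continuous_on S (\<lambda>x. f' (g x) o\<^sub>L g' x)"
      using g'(2) by (intro continuous_intros)
  qed
qed

lemma C1_on_add:
  assumes "C1_on S f" "C1_on S g"
  shows "C1_on S (\<lambda>x. f x + g x)"
proof -
  obtain f' where f': "\<And>x. x \<in> S \<Longrightarrow> (f has_derivative blinfun_apply (f' x)) (at x)"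
    "continuous_on S f'"
    using assms(1) by (rule C1_onE) blast
  obtain g' where g': "\<And>x. x \<in> S \<Longrightarrow> (g has_derivative blinfun_apply (g' x)) (at x)"
    "continuous_on S g'"
    using assms(2) by (rule C1_onE) blast
  show ?thesis
    by (rule C1_onI[where f' = "\<lambda>x. f' x + g' x"])
      (auto intro!: derivative_eq_intros continuous_intros f' g' simp: blinfun.add_left)
qed

lemma C1_on_mult:
  fixes f g :: "'a::real_normed_vector \<Rightarrow> real"
  assumes "C1_on S f" "C1_on S g"
  shows "C1_on S (\<lambda>x. f x * g x)"
proof -
  obtain f' where f': "\<And>x. x \<in> S \<Longrightarrow> (f has_derivative blinfun_apply (f' x)) (at x)"
    "continuous_on S f'"
    using assms(1) by (rule C1_onE) blast
  obtain g' where g': "\<And>x. x \<in> S \<Longrightarrow> (g has_derivative blinfun_apply (g' x)) (at x)"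
    "continuous_on S g'"
    using assms(2) by (rule C1_onE) blast
  show ?thesis
    by (rule C1_onI[where f' = "\<lambda>x. f x *\<^sub>R g' x + g x *\<^sub>R f' x"])
      (auto intro!: derivative_eq_intros continuous_intros f' g' C1_on_imp_continuous_on[OF assms(1)]
        C1_on_imp_continuous_on[OF assms(2)] simp: blinfun.add_left blinfun.scaleR_left)
qed

lemma C1_on_sum:
  assumes "\<And>i. i \<in> I \<Longrightarrow> C1_on S (f i)"
  shows "C1_on S (\<lambda>x. \<Sum>i\<in>I. f i x)"
  using assms by (induction I rule: infinite_finite_induct) (auto intro: C1_on_add)

lemma C1_on_prod:
  fixes f :: "'i \<Rightarrow> 'a::real_normed_vector \<Rightarrow> real"
  assumes "\<And>i. i \<in> I \<Longrightarrow> C1_on S (f i)"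
  shows "C1_on S (\<lambda>x. \<Prod>i\<in>I. f i x)"
  using assms by (induction I rule: infinite_finite_induct) (auto intro: C1_on_mult)

lemma C1_on_real:
  fixes f :: "real \<Rightarrow> real"
  assumes "\<And>x. x \<in> S \<Longrightarrow> (f has_real_derivative f' x) (at x)" "continuous_on S f'"
  shows "C1_on S f"
  by (rule C1_onI[where f' = "\<lambda>x. f' x *\<^sub>R id_blinfun"])
    (use assms in \<open>auto intro!: continuous_intros simp: has_field_derivative_def
      blinfun.scaleR_left[abs_def]\<close>)

lemma C1_on_inverse: "C1_on {0<..} (inverse :: real \<Rightarrow> real)"
  by (rule C1_on_real) (auto intro!: derivative_eq_intros continuous_intros simp: power2_eq_square)

lemma C1_on_sqrt: "C1_on {0<..} sqrt"
  by (rule C1_on_real[where f' = "\<lambda>x. inverse (sqrt x) / 2"])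
    (auto intro!: derivative_eq_intros continuous_intros)

text \<open>Profile of the bump functions. Squaring removes the corner of the positive part: at 0
  the difference quotient is bounded by \<open>\<bar>h\<bar>\<close>.\<close>

lemma C1_on_square_max: "C1_on UNIV (\<lambda>t::real. (max 0 t)\<^sup>2)"
proof (rule C1_on_real[where f' = "\<lambda>t. 2 * max 0 t"])
  fix t :: real
  consider "t > 0" | "t < 0" | "t = 0" by linarith
  then show "((\<lambda>t. (max 0 t)\<^sup>2) has_real_derivative 2 * max 0 t) (at t)"
  proof cases
    case 1
    have "((\<lambda>t. t\<^sup>2) has_real_derivative 2 * max 0 t) (at t)"
      using 1 by (auto intro!: derivative_eq_intros)
    then show ?thesis
      by (rule has_field_derivative_transform_within_open[where S = "{0<..}"]) (use 1 in auto)
  next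
    case 2
    have "((\<lambda>t. 0) has_real_derivative 2 * max 0 t) (at t)"
      using 2 by (auto intro!: derivative_eq_intros)
    then show ?thesis
      by (rule has_field_derivative_transform_within_open[where S = "{..<0}"]) (use 2 in auto)
  next
    case 3
    have "((\<lambda>h. (max 0 h)\<^sup>2 / h) \<longlongrightarrow> 0) (at (0::real))"
    proof (rule Lim_null_comparison)
      show "\<forall>\<^sub>F h in at (0::real). norm ((max 0 h)\<^sup>2 / h) \<le> \<bar>h\<bar>"
        by (rule always_eventually) (auto simp: max_def power2_eq_square)
      show "((\<lambda>h::real. \<bar>h\<bar>) \<longlongrightarrow> 0) (at 0)"
        by (auto intro!: tendsto_eq_intros)
    qed
    then show ?thesis
      using 3 by (simp add: DERIV_def)
  qed
qed (auto intro!: continuous_intros)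

text \<open>The hypothesis controls partial derivatives one at a time. In finite dimension,
  continuity of an operator-valued map can be tested on basis vectors, which turns this into
  continuity in operator norm.\<close>

lemma Ck_on_Suc_0_imp_C1_on:
  fixes f :: "real^'n::finite \<Rightarrow> 'b::real_normed_vector"
  assumes "Ck_on (Suc 0) S f"
  shows "C1_on S f"
proof (rule C1_onI)
  have D: "bounded_linear (frechet_derivative f (at x))" "f differentiable (at x)" if "x \<in> S" for x
    using assms that by (auto simp: linear_frechet_derivative linear_conv_bounded_linear[symmetric])
  show "(f has_derivative blinfun_apply (Blinfun (frechet_derivative f (at x)))) (at x)"
    if "x \<in> S" for x
    using D[OF that] by (simp add: bounded_linear_Blinfun_apply frechet_derivative_works)
  show "continuous_on S (\<lambda>x. Blinfun (frechet_derivative f (at x)))"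
  proof (rule continuous_on_blinfun_componentwise)
    fix b :: "real^'n" assume "b \<in> Basis"
    then obtain i where b: "b = axis i 1"
      by (auto simp: Basis_vec_def)
    have "continuous_on S (pd i f)"
      using assms by simp
    then show "continuous_on S (\<lambda>x. blinfun_apply (Blinfun (frechet_derivative f (at x))) b)"
      by (rule continuous_on_eq) (simp add: D bounded_linear_Blinfun_apply pd_def b)
  qed
qed

lemma smooth_on_imp_C1_on:
  fixes f :: "real^'n::finite \<Rightarrow> 'b::real_normed_vector"
  shows "smooth_on S f \<Longrightarrow> C1_on S f"
  using Ck_on_Suc_0_imp_C1_on unfolding smooth_on_def by blast

lemma C1_on_vec_nth: "C1_on S f \<Longrightarrow> C1_on S (\<lambda>x. f x $ i)"
  by (rule C1_on_compose[OF C1_on_bounded_linear[OF bounded_linear_vec_nth, of UNIV]]) auto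

text \<open>The open sets \<open>S\<close> and \<open>- C\<close> cover the space because
  \<open>C\<close> lies in \<open>S\<close>, and the extension is 0 on \<open>- C\<close>. It turns
  a cutoff coordinate expression into a function on all of Euclidean space.\<close>

lemma C1_on_extend_zero:
  fixes f :: "'a::euclidean_space \<Rightarrow> 'b::real_normed_vector"
  assumes f: "C1_on S f" and S: "open S" and C: "compact C" "C \<subseteq> S"
    and 0: "\<And>x. x \<in> S - C \<Longrightarrow> f x = 0"
  shows "C1_on UNIV (\<lambda>x. if x \<in> S then f x else 0)"
proof (rule C1_on_local)
  fix x
  show "\<exists>U. open U \<and> x \<in> U \<and> C1_on U (\<lambda>x. if x \<in> S then f x else 0)"
  proof (cases "x \<in> S")
    case True
    then show ?thesis
      using C1_on_cong_open[OF f S, of "\<lambda>x. if x \<in> S then f x else 0"] S by auto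
  next
    case False
    have *: "open (- C)" using C by (simp add: compact_imp_closed open_Compl)
    have "C1_on (-C) (\<lambda>x. if x \<in> S then f x else 0)"
      by (rule C1_on_cong_open[OF C1_on_const[of _ 0] *]) (use 0 in auto)
    then show ?thesis
      using * False C by blast
  qed
qed

section \<open>Determinants: differentiability, Jacobi's formula, positivity\<close>

lemma C1_on_det:
  fixes G :: "'a::real_normed_vector \<Rightarrow> real^'n::finite^'n"
  assumes "C1_on S G"
  shows "C1_on S (\<lambda>x. det (G x))"
  unfolding det_def
  by (intro C1_on_sum C1_on_mult C1_on_const C1_on_prod C1_on_vec_nth assms)

text \<open>Differentiate the Leibniz sum. A permutation other than the identity moves at least two
  indices, so after one factor is replaced by an entry of \<open>H\<close> an off-diagonal zero of
  the identity matrix remains. Only \<open>id\<close> contributes, and it gives the trace.\<close>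

lemma has_derivative_det_mat_1:
  "(det has_derivative trace) (at (mat 1 :: real^'n::finite^'n))"
proof -
  define D where "D H = (\<Sum>p\<in>{p. p permutes (UNIV::'n set)}. of_int (sign p) *
      (\<Sum>i\<in>UNIV. H $ i $ p i * (\<Prod>j\<in>UNIV - {i}. (mat 1 :: real^'n^'n) $ j $ p j)))" for H :: "real^'n^'n"
  have "((\<lambda>A. \<Sum>p\<in>{p. p permutes (UNIV::'n set)}. of_int (sign p) * (\<Prod>i\<in>UNIV. A $ i $ p i))
      has_derivative D) (at (mat 1 :: real^'n^'n))"
    unfolding D_def
    by (auto intro!: derivative_eq_intros has_derivative_prod bounded_linear.has_derivative[OF bounded_linear_vec_nth])
  moreover have "D H = trace H" for H
  proof -
    have *: "(\<Sum>i\<in>UNIV. H $ i $ p i * (\<Prod>j\<in>UNIV - {i}. (mat 1 :: real^'n^'n) $ j $ p j)) = 0"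
      if p: "p permutes UNIV" "p \<noteq> id" for p :: "'n \<Rightarrow> 'n"
    proof (rule sum.neutral, rule ballI)
      fix i
      have "\<exists>j. j \<noteq> i \<and> p j \<noteq> j"
      proof (rule ccontr)
        assume "\<not> ?thesis"
        then have *: "\<And>j. j \<noteq> i \<Longrightarrow> p j = j" by blast
        then have "p i = i"
          by (metis p(1) permutes_inj injD)
        with * have "p = id" by fastforce
        with p show False by blast
      qed
      then obtain j where "j \<noteq> i" "p j \<noteq> j" by blast
      then have "(\<Prod>j\<in>UNIV - {i}. (mat 1 :: real^'n^'n) $ j $ p j) = 0"
        by (intro prod_zero) (auto simp: mat_def intro!: bexI[of _ j])
      then show "H $ i $ p i * (\<Prod>j\<in>UNIV - {i}. (mat 1 :: real^'n^'n) $ j $ p j) = 0" by simp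
    qed
    have "D H = (\<Sum>p\<in>{id}. of_int (sign p) *
      (\<Sum>i\<in>UNIV. H $ i $ p i * (\<Prod>j\<in>UNIV - {i}. (mat 1 :: real^'n^'n) $ j $ p j)))"
      unfolding D_def by (rule sum.mono_neutral_right) (auto simp: permutes_id * simp del: id_apply)
    also have "\<dots> = trace H"
      by (simp add: trace_def mat_def sign_id)
    finally show ?thesis .
  qed
  ultimately show ?thesis
    unfolding det_def[abs_def] by (simp add: fun_eq_iff[of D trace, symmetric] ext[of D trace])
qed

lemma invertible_matrix_inv:
  fixes A :: "'a::semiring_1^'n^'n"
  assumes "invertible A"
  shows "A ** matrix_inv A = mat 1" "matrix_inv A ** A = mat 1"
  using someI_ex[OF assms[unfolded invertible_def]] by (simp_all add: matrix_inv_def)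

text \<open>Multiplicativity, \<open>det A = det B * det (matrix_inv B ** A)\<close>, moves the base
  point from \<open>B\<close> to the identity.\<close>

lemma has_derivative_det:
  fixes B :: "real^'n::finite^'n"
  assumes "invertible B"
  shows "(det has_derivative (\<lambda>H. det B * trace (matrix_inv B ** H))) (at B)"
proof -
  have lin: "linear (\<lambda>A::real^'n^'n. matrix_inv B ** A)"
    by (rule linearI) (auto simp: matrix_add_ldistrib matrix_scalar_ac simp flip: scalar_matrix_assoc)
  have 1: "matrix_inv B ** B = mat 1" "B ** matrix_inv B = mat 1"
    using assms by (simp_all add: invertible_matrix_inv)
  have "((\<lambda>A. det B * det (matrix_inv B ** A)) has_derivative (\<lambda>H. det B * trace (matrix_inv B ** H))) (at B)"
  proof (rule has_derivative_mult_right)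
    have "((\<lambda>A. matrix_inv B ** A) has_derivative (\<lambda>A. matrix_inv B ** A)) (at B)"
      using lin by (intro bounded_linear_imp_has_derivative) (simp add: linear_conv_bounded_linear)
    then show "((\<lambda>A. det (matrix_inv B ** A)) has_derivative (\<lambda>H. trace (matrix_inv B ** H))) (at B)"
      by (rule has_derivative_compose) (simp add: 1 has_derivative_det_mat_1)
  qed
  moreover have "det B * det (matrix_inv B ** A) = det A" for A
    by (metis 1(2) det_mul matrix_mul_assoc matrix_mul_lid)
  ultimately show ?thesis
    by simp
qed

text \<open>Along the segment \<open>F\<close> from the identity to \<open>G\<close> the quadratic
  form stays positive, so the kernel stays trivial and the determinant never vanishes. It starts at
  1 and by the intermediate value theorem keeps its sign.\<close>

lemma posdef_det_pos:
  fixes G :: "real^'n::finite^'n"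
  assumes "\<And>v. v \<noteq> 0 \<Longrightarrow> v \<bullet> (G *v v) > 0"
  shows "det G > 0"
proof -
  define F where "F t = (1 - t) *\<^sub>R mat 1 + t *\<^sub>R G" for t :: real
  have nz: "det (F t) \<noteq> 0" if "0 \<le> t" "t \<le> 1" for t
  proof
    assume "det (F t) = 0"
    then have "\<not> invertible (F t)" by (simp add: invertible_det_nz)
    then obtain v where v: "v \<noteq> 0" "F t *v v = 0"
      by (metis invertible_left_inverse matrix_left_invertible_ker)
    have "v \<bullet> (F t *v v) = (1 - t) * (v \<bullet> v) + t * (v \<bullet> (G *v v))"
      by (simp add: F_def matrix_vector_mult_add_rdistrib scaleR_matrix_vector_assoc[symmetric] inner_add_right)
    moreover have "v \<bullet> v > 0" "v \<bullet> (G *v v) > 0" using v assms by auto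
    ultimately have "v \<bullet> (F t *v v) > 0"
      using that by (cases "t = 0") (auto simp: add_nonneg_pos)
    with v show False by simp
  qed
  have "continuous_on {0..1} (\<lambda>t. det (F t))"
    unfolding F_def by (intro C1_on_imp_continuous_on C1_on_det)
      (rule C1_onI[where f' = "\<lambda>_. blinfun_scaleR_left (G - mat 1)"],
        auto intro!: derivative_eq_intros simp: algebra_simps)
  then have "\<exists>t. 0 \<le> t \<and> t \<le> 1 \<and> det (F t) = 0" if "det G \<le> 0"
    using that IVT2'[of "\<lambda>t. det (F t)" 1 0 0] by (auto simp: F_def)
  then show ?thesis
    using nz by force
qed

text \<open>The difference quotients of \<open>h\<close> have integral zero by translation invariance, and they converge
  dominatedly to the derivative.\<close>

lemma lborel_integral_frechet_derivative_zero:
  fixes h :: "'a::euclidean_space \<Rightarrow> real"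
  assumes h: "C1_on UNIV h" and C: "compact C" and 0: "\<And>x. x \<notin> C \<Longrightarrow> h x = 0"
  shows "integrable lborel (\<lambda>x. frechet_derivative h (at x) v)"
    and "(\<integral>x. frechet_derivative h (at x) v \<partial>lborel) = 0"
proof -
  define D where "D x = frechet_derivative h (at x) v" for x
  obtain R where R: "R > 0" "C \<subseteq> ball 0 R"
    using C compact_imp_bounded bounded_subset_ballD by metis
  \<comment> \<open>The quotients \<open>q k\<close> shift by at most \<open>norm v\<close>, since
    their step \<open>1 / (k + 1)\<close> is at most 1. Hence they vanish outside
    \<open>K\<close>.\<close>
  define K where "K = cball (0::'a) (R + norm v)"
  have cont: "continuous_on UNIV h" "continuous_on UNIV D"
    unfolding D_def by (auto intro: C1_on_imp_continuous_on h continuous_on_frechet_derivative)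
  \<comment> \<open>The second \<open>norm v\<close> makes room for the intermediate points
    \<open>x + \<xi> *\<^sub>R v\<close> of the mean value theorem with \<open>x\<close> in
    \<open>K\<close>.\<close>
  have "bounded (D ` cball 0 (R + norm v + norm v))"
    by (intro compact_imp_bounded compact_continuous_image continuous_on_subset[OF cont(2)]) auto
  then obtain B where B: "\<And>x. x \<in> cball 0 (R + norm v + norm v) \<Longrightarrow> \<bar>D x\<bar> \<le> B"
    unfolding bounded_iff by (metis image_eqI real_norm_def)
  define q where "q k x = (h (x + inverse (real (Suc k)) *\<^sub>R v) - h x) * real (Suc k)" for k x
  have inth: "integrable lborel h"
  proof -
    have "integrable lborel (\<lambda>x. indicator C x *\<^sub>R h x)"
      by (intro borel_integrable_compact C continuous_on_subset[OF cont(1)]) auto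
    moreover have "(\<lambda>x. indicator C x *\<^sub>R h x) = h" using 0 by (auto simp: indicator_def fun_eq_iff)
    ultimately show ?thesis by simp
  qed
  have shift: "integrable lborel (\<lambda>x. h (x + a)) \<and> (\<integral>x. h (x + a) \<partial>lborel) = (\<integral>x. h x \<partial>lborel)" for a
    using inth integrable_distr_eq[of "(+) a" lborel borel h] integral_distr[of "(+) a" lborel borel h]
    by (auto simp: lborel_distr_plus add.commute)
  have qint: "(\<integral>x. q k x \<partial>lborel) = 0" "q k \<in> borel_measurable lborel" for k
    using shift inth unfolding q_def by (auto simp: cont(1) borel_measurable_continuous_onI)
  have lim: "(\<lambda>k. q k x) \<longlonglongrightarrow> D x" for x
  proof -
    have "((\<lambda>t. h (x + t *\<^sub>R v)) has_derivative (\<lambda>t. frechet_derivative h (at x) (t *\<^sub>R v))) (at 0)"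
      by (rule has_derivative_compose[where g = h and f = "\<lambda>t. x + t *\<^sub>R v"])
        (auto intro!: derivative_eq_intros C1_on_has_frechet_derivative[OF h])
    moreover have "linear (frechet_derivative h (at x))"
      using C1_on_has_frechet_derivative[OF h, of x] has_derivative_linear by blast
    ultimately have "((\<lambda>t. h (x + t *\<^sub>R v)) has_real_derivative D x) (at 0)"
      by (simp add: has_field_derivative_def D_def linear_cmul mult_commute_abs)
    then have "((\<lambda>t. (h (x + t *\<^sub>R v) - h x) / t) \<longlongrightarrow> D x) (at 0)"
      by (simp add: DERIV_def)
    moreover have "filterlim (\<lambda>k. inverse (real (Suc k))) (at 0) sequentially"
      by (auto simp: filterlim_at LIMSEQ_inverse_real_of_nat simp del: of_nat_Suc)
    ultimately show ?thesis
      unfolding q_def by (auto dest: filterlim_compose simp: divide_inverse)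
  qed
  have qB: "norm (q k x) \<le> indicator K x * B" for k x
  proof (cases "x \<in> K")
    case True
    define t where "t = inverse (real (Suc k))"
    have t: "0 < t" "t \<le> 1" by (auto simp: t_def field_simps)
    have "\<exists>\<xi>\<in>{0..t}. h (x + t *\<^sub>R v) - h (x + 0 *\<^sub>R v) = (\<lambda>s. s * D (x + \<xi> *\<^sub>R v)) (t - 0)"
    proof (rule mvt_very_simple)
      fix s assume "0 \<le> s" "s \<le> t"
      have "((\<lambda>t. h (x + t *\<^sub>R v)) has_derivative (\<lambda>t. frechet_derivative h (at (x + s *\<^sub>R v)) (t *\<^sub>R v))) (at s)"
        by (rule has_derivative_compose[where g = h and f = "\<lambda>t. x + t *\<^sub>R v"])
          (auto intro!: derivative_eq_intros C1_on_has_frechet_derivative[OF h])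
      moreover have "linear (frechet_derivative h (at (x + s *\<^sub>R v)))"
        using C1_on_has_frechet_derivative[OF h] has_derivative_linear by blast
      ultimately show "((\<lambda>t. h (x + t *\<^sub>R v)) has_derivative (\<lambda>t. t * D (x + s *\<^sub>R v))) (at s within {0..t})"
        by (auto simp: D_def linear_cmul intro: has_derivative_at_withinI)
    qed (use t in auto)
    then obtain \<xi> where \<xi>: "\<xi> \<in> {0..t}" "h (x + t *\<^sub>R v) - h x = t * D (x + \<xi> *\<^sub>R v)" by auto
    have "norm (x + \<xi> *\<^sub>R v) \<le> (R + norm v) + norm v"
    proof (rule norm_triangle_mono)
      show "norm (\<xi> *\<^sub>R v) \<le> norm v"
        using \<xi> t by (auto intro!: mult_left_le_one_le)
    qed (use True in \<open>simp add: K_def\<close>)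
    then have "\<bar>D (x + \<xi> *\<^sub>R v)\<bar> \<le> B" by (intro B) simp
    moreover have "q k x = D (x + \<xi> *\<^sub>R v)"
      unfolding q_def using \<xi>(2) by (simp add: t_def field_simps)
    ultimately show ?thesis using True by simp
  next
    case False
    then have x: "norm x > R + norm v" by (simp add: K_def)
    have "h x = 0" using x R by (intro 0) (smt (verit) mem_ball_0 norm_ge_zero subsetD)
    moreover have "norm (inverse (real (Suc k)) *\<^sub>R v) \<le> norm v"
      by (auto intro!: mult_left_le_one_le simp: field_simps)
    then have "norm (x + inverse (real (Suc k)) *\<^sub>R v) \<ge> R"
      using x norm_triangle_ineq4[of "x + inverse (real (Suc k)) *\<^sub>R v" "inverse (real (Suc k)) *\<^sub>R v"] by simp
    then have "h (x + inverse (real (Suc k)) *\<^sub>R v) = 0"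
      using R by (intro 0) (meson linorder_not_le mem_ball_0 subsetD)
    ultimately show ?thesis
      by (simp add: q_def False)
  qed
  have intK: "integrable lborel (\<lambda>x. indicator K x * B)"
    using borel_integrable_compact[of K "\<lambda>_. B"] by (simp add: K_def)
  have mD: "D \<in> borel_measurable lborel"
    using cont(2) by (simp add: borel_measurable_continuous_onI)
  have "integrable lborel D"
    by (rule integrable_dominated_convergence[OF mD qint(2) intK AE_I2[OF lim] AE_I2[OF qB]])
  then show "integrable lborel (\<lambda>x. frechet_derivative h (at x) v)"
    by (simp add: D_def[abs_def])
  have "(\<lambda>k. \<integral>x. q k x \<partial>lborel) \<longlonglongrightarrow> (\<integral>x. D x \<partial>lborel)"
    by (rule integral_dominated_convergence[OF mD qint(2) intK AE_I2[OF lim] AE_I2[OF qB]])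
  then show "(\<integral>x. frechet_derivative h (at x) v \<partial>lborel) = 0"
    unfolding qint(1) by (simp add: D_def LIMSEQ_const_iff)
qed

section \<open>Change of variables\<close>

text \<open>The library's change of variables theorem needs a well-ordered index type. A copy of an
  arbitrary finite type carries such an order.\<close>

datatype 'a ordered = Ordered (unordered: 'a)

lemma bij_unordered: "bij unordered"
  by (metis bijI' ordered.exhaust_sel ordered.sel)

instance ordered :: (finite) finite
proof
  have "(UNIV :: 'a ordered set) = range Ordered"
    by (metis UNIV_eq_I ordered.exhaust_sel rangeI)
  then show "finite (UNIV :: 'a ordered set)"
    by (metis finite finite_imageI)
qed

text \<open>An arbitrary enumeration. The order is pulled back from the natural numbers along it, so
  injectivity gives antisymmetry and well-foundedness is inherited.\<close>

definition finite_index :: "'a::finite \<Rightarrow> nat"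
  where "finite_index = (SOME f. inj f)"

lemma inj_finite_index: "inj (finite_index :: 'a::finite \<Rightarrow> nat)"
proof -
  have "\<exists>f :: 'a \<Rightarrow> nat. inj f"
    using finite_imp_inj_to_nat_seg[of "UNIV :: 'a set"] by auto
  then show ?thesis
    unfolding finite_index_def by (rule someI_ex)
qed

instantiation ordered :: (finite) wellorder
begin

definition less_eq_ordered :: "'a ordered \<Rightarrow> 'a ordered \<Rightarrow> bool"
  where "less_eq_ordered a b \<longleftrightarrow> finite_index (unordered a) \<le> finite_index (unordered b)"

definition less_ordered :: "'a ordered \<Rightarrow> 'a ordered \<Rightarrow> bool"
  where "less_ordered a b \<longleftrightarrow> finite_index (unordered a) < finite_index (unordered b)"

instance
proof
  fix a b :: "'a ordered"
  show "a \<le> b \<Longrightarrow> b \<le> a \<Longrightarrow> a = b"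
    by (metis antisym injD inj_finite_index less_eq_ordered_def ordered.expand)
next
  fix P :: "'a ordered \<Rightarrow> bool" and a
  assume *: "\<And>a. (\<And>b. b < a \<Longrightarrow> P b) \<Longrightarrow> P a"
  show "P a"
    by (induction "finite_index (unordered a)" arbitrary: a rule: less_induct)
      (metis * less_ordered_def)
qed (auto simp: less_eq_ordered_def less_ordered_def)

end

section \<open>Relabelling coordinates along a bijection of index types\<close>

definition reindex :: "('m \<Rightarrow> 'n) \<Rightarrow> real^'n \<Rightarrow> real^'m"
  where "reindex u x = (\<chi> i. x $ u i)"

lemma reindex_inv:
  assumes "bij u"
  shows "reindex (inv u) (reindex u x) = x" "reindex u (reindex (inv u) y) = y"
  using assms by (simp_all add: reindex_def vec_eq_iff bij_is_surj surj_f_inv_f bij_is_inj)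

lemma linear_reindex: "linear (reindex u :: real^'n::finite \<Rightarrow> real^'m::finite)"
  by (rule linearI) (auto simp: reindex_def vec_eq_iff)

lemma inj_reindex: "bij u \<Longrightarrow> inj (reindex u)"
  by (metis reindex_inv(1) injI)

lemma norm_reindex:
  fixes u :: "'m::finite \<Rightarrow> 'n::finite"
  shows "bij u \<Longrightarrow> norm (reindex u x) = norm x"
  unfolding norm_vec_def L2_set_def reindex_def
  using sum.reindex_bij_betw[of u UNIV UNIV "\<lambda>i. (norm (x $ i))\<^sup>2"] by simp

lemma reindex_cbox:
  fixes u :: "'m::finite \<Rightarrow> 'n::finite"
  assumes "bij u"
  shows "reindex u ` cbox a b = cbox (reindex u a) (reindex u b)"
proof -
  have "y \<in> reindex u ` cbox a b" if y: "y \<in> cbox (reindex u a) (reindex u b)" for y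
  proof (rule image_eqI)
    show "y = reindex u (reindex (inv u) y)" by (simp add: reindex_inv assms)
    have "a $ i \<le> y $ inv u i \<and> y $ inv u i \<le> b $ i" for i
      using y assms unfolding mem_box_cart reindex_def
      by (metis bij_is_surj surj_f_inv_f vec_lambda_beta)
    then show "reindex (inv u) y \<in> cbox a b"
      by (simp add: mem_box_cart reindex_def)
  qed
  then show ?thesis
    by (auto simp: mem_box_cart reindex_def)
qed

lemma content_reindex_cbox:
  fixes u :: "'m::finite \<Rightarrow> 'n::finite"
  assumes "bij u"
  shows "measure lborel (reindex u ` cbox a b) = measure lborel (cbox a b)"
proof (cases "cbox a b = {}")
  case False
  then have "cbox (reindex u a) (reindex u b) \<noteq> {}"
    by (simp flip: reindex_cbox[OF assms])
  with False show ?thesis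
    using prod.reindex_bij_betw[OF assms, of "\<lambda>i. b $ i - a $ i"]
    unfolding reindex_cbox[OF assms] by (simp add: content_cbox_cart reindex_def)
qed auto

text \<open>Relabelling takes boxes to boxes of the same content, which settles integrals over
  boxes. It also preserves norms, so a large ball inside a box goes to the same ball inside the
  image box; this carries the limit over growing boxes that defines the integral over the whole
  space.\<close>

lemma has_integral_reindex:
  fixes u :: "'m::finite \<Rightarrow> 'n::finite" and f :: "real^'m \<Rightarrow> real"
  assumes u: "bij u" and f: "(f has_integral i) (reindex u ` S)"
  shows "((\<lambda>x. f (reindex u x)) has_integral i) S"
proof -
  define F where "F y = (if y \<in> reindex u ` S then f y else 0)" for y
  have F: "(F has_integral i) UNIV"
    using f unfolding F_def by (simp add: has_integral_restrict_UNIV)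
  have cb: "((\<lambda>x. F (reindex u x)) has_integral z) (cbox a b)"
    if z: "(F has_integral z) (cbox (reindex u a) (reindex u b))" for z a b
  proof -
    \<comment> \<open>The scaling factor is the ratio of contents, here 1.\<close>
    have "((\<lambda>x. F (reindex u x)) has_integral (1 / 1) *\<^sub>R z)
        (reindex (inv u) ` cbox (reindex u a) (reindex u b))"
    proof (rule has_integral_twiddle[OF _ _ _ _ _ _ _ z])
      show "isCont (reindex u) x" for x
        by (simp add: linear_continuous_at linear_conv_bounded_linear[symmetric] linear_reindex)
      show "\<exists>w z. reindex u ` cbox a b = cbox w z" for a b
        using reindex_cbox[OF u] by blast
      show "\<exists>w z. reindex (inv u) ` cbox a b = cbox w z" for a b
        using reindex_cbox[OF bij_imp_bij_inv[OF u]] by blast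
    qed (simp_all add: reindex_inv u content_reindex_cbox)
    then show ?thesis
      by (simp add: reindex_cbox bij_imp_bij_inv u reindex_inv)
  qed
  have "((\<lambda>x. F (reindex u x)) has_integral i) UNIV"
    unfolding has_integral_alt'
  proof safe
    show "(\<lambda>x. if x \<in> UNIV then F (reindex u x) else 0) integrable_on cbox a b" for a b
    proof -
      have "F integrable_on cbox (reindex u a) (reindex u b)"
        using F by (simp add: has_integral_alt')
      then show ?thesis using cb by (auto simp: integrable_on_def)
    qed
    fix e :: real assume "e > 0"
    then obtain B where B: "B > 0" "\<And>a b. ball 0 B \<subseteq> cbox a b \<Longrightarrow>
        norm (integral (cbox a b) F - i) < e"
      using F unfolding has_integral_alt' by auto
    have "norm (integral (cbox a b) (\<lambda>x. F (reindex u x)) - i) < e" if ab: "ball 0 B \<subseteq> cbox a b" for a b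
    proof -
      have "ball 0 B \<subseteq> reindex u ` cbox a b"
      proof
        fix y :: "real^'m" assume "y \<in> ball 0 B"
        then have "reindex (inv u) y \<in> ball 0 B"
          by (simp add: norm_reindex bij_imp_bij_inv u)
        then show "y \<in> reindex u ` cbox a b"
          using ab by (metis image_eqI subsetD reindex_inv(2) u)
      qed
      then have "norm (integral (cbox (reindex u a) (reindex u b)) F - i) < e"
        by (intro B) (simp add: reindex_cbox u)
      moreover have "F integrable_on cbox (reindex u a) (reindex u b)"
        using F by (simp add: has_integral_alt')
      ultimately show ?thesis
        using cb by (metis has_integral_integral integral_unique)
    qed
    with B show "\<exists>B>0. \<forall>a b. ball 0 B \<subseteq> cbox a b \<longrightarrow>
        norm (integral (cbox a b) (\<lambda>x. if x \<in> UNIV then F (reindex u x) else 0) - i) < e"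
      by auto
  qed
  moreover have "F (reindex u x) = (if x \<in> S then f (reindex u x) else 0)" for x
    by (auto simp: F_def inj_image_mem_iff[OF inj_reindex[OF u]])
  ultimately show ?thesis
    by (simp add: has_integral_restrict_UNIV)
qed

lemma absolutely_integrable_reindex:
  fixes u :: "'m::finite \<Rightarrow> 'n::finite" and f :: "real^'m \<Rightarrow> real"
  assumes u: "bij u" and f: "f absolutely_integrable_on (reindex u ` S)"
  shows "(\<lambda>x. f (reindex u x)) absolutely_integrable_on S"
    and "integral S (\<lambda>x. f (reindex u x)) = integral (reindex u ` S) f"
proof -
  have f: "f integrable_on (reindex u ` S)" "(\<lambda>x. norm (f x)) integrable_on (reindex u ` S)"
    using f by (auto simp: absolutely_integrable_on_def)
  show "integral S (\<lambda>x. f (reindex u x)) = integral (reindex u ` S) f"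
    using has_integral_reindex[OF u integrable_integral[OF f(1)]] by (rule integral_unique)
  show "(\<lambda>x. f (reindex u x)) absolutely_integrable_on S"
    using has_integral_reindex[OF u integrable_integral[OF f(1)]]
      has_integral_reindex[OF u integrable_integral[OF f(2)]]
    by (auto simp: absolutely_integrable_on_def integrable_on_def)
qed

text \<open>The conjugate lives on another type, so the argument is an induction over
  transpositions: conjugating the swap of \<open>a\<close> and \<open>b\<close> gives the swap of
  \<open>inv u a\<close> and \<open>inv u b\<close>.\<close>

lemma sign_conj_bij:
  fixes u :: "'a::finite \<Rightarrow> 'b::finite"
  assumes u: "bij u" and p: "p permutes UNIV"
  shows "sign (inv u \<circ> p \<circ> u) = sign p"
proof -
  have fin: "permutation q" if "bij q" for q :: "'c::finite \<Rightarrow> 'c"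
    using that by (simp add: permutation)
  have iu: "u (inv u x) = x" "inv u (u y) = y" for x y
    using u by (simp_all add: bij_is_surj surj_f_inv_f bij_is_inj inv_f_f)
  show ?thesis
    using p finite_class.finite_UNIV
  proof (induction p rule: permutes_induct)
    case id
    then show ?case by (simp add: iu o_def id_def[symmetric])
  next
    case (swap a b p)
    have "inv u \<circ> (Transposition.transpose a b \<circ> p) \<circ> u = (inv u \<circ> Transposition.transpose a b \<circ> u) \<circ> (inv u \<circ> p \<circ> u)"
      by (simp add: iu fun_eq_iff)
    also have "inv u \<circ> Transposition.transpose a b \<circ> u = Transposition.transpose (inv u a) (inv u b)"
      by (auto simp: fun_eq_iff Transposition.transpose_def iu)
    finally have e: "inv u \<circ> (Transposition.transpose a b \<circ> p) \<circ> u = Transposition.transpose (inv u a) (inv u b) \<circ> (inv u \<circ> p \<circ> u)" .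
    have "bij p" "bij (inv u \<circ> p \<circ> u)"
      using swap u by (auto simp: permutes_bij bij_imp_bij_inv intro!: bij_comp)
    moreover have "inv u a \<noteq> inv u b"
      using swap.hyps iu by metis
    ultimately show ?case
      using swap unfolding e
      by (simp add: sign_compose fin sign_swap_id permutation_swap_id del: comp_apply)
  qed
qed

text \<open>Rows and columns are relabelled alike, so conjugation by \<open>u\<close> matches the
  Leibniz terms, and it preserves signs.\<close>

lemma det_reindex:
  fixes A :: "real^'n::finite^'n" and u :: "'m::finite \<Rightarrow> 'n"
  assumes u: "bij u"
  shows "det (\<chi> i j. A $ u i $ u j) = det A"
proof -
  have iu: "u (inv u x) = x" "inv u (u y) = y" for x y
    using u by (simp_all add: bij_is_surj surj_f_inv_f bij_is_inj inv_f_f)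
  have "det A = (\<Sum>p\<in>{p. p permutes (UNIV::'n set)}. of_int (sign (inv u \<circ> p \<circ> u)) * (\<Prod>i\<in>UNIV. A $ i $ p i))"
    unfolding det_def by (intro sum.cong) (auto simp: sign_conj_bij[OF u])
  also have "\<dots> = (\<Sum>p\<in>{p. p permutes (UNIV::'m set)}. of_int (sign p) *
      (\<Prod>i\<in>UNIV. (\<chi> i j. A $ u i $ u j) $ i $ p i))"
  proof (rule sum.reindex_bij_witness[where j = "\<lambda>p. inv u \<circ> p \<circ> u" and i = "\<lambda>p. u \<circ> p \<circ> inv u"])
    fix p assume "p \<in> {p. p permutes (UNIV::'n set)}"
    then show "inv u \<circ> p \<circ> u \<in> {p. p permutes (UNIV::'m set)}"
      using u by (auto simp: bij_imp_bij_inv permutes_bij intro!: bij_comp bij_imp_permutes)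
    have "(\<Prod>i\<in>UNIV. A $ u i $ p (u i)) = (\<Prod>i\<in>UNIV. A $ i $ p i)"
      by (rule prod.reindex_bij_betw[OF u])
    then show "of_int (sign (inv u \<circ> p \<circ> u)) * (\<Prod>i\<in>UNIV. (\<chi> i j. A $ u i $ u j) $ i $ (inv u \<circ> p \<circ> u) i)
        = of_int (sign (inv u \<circ> p \<circ> u)) * (\<Prod>i\<in>UNIV. A $ i $ p i)"
      by (simp add: iu)
  next
    fix p assume "p \<in> {p. p permutes (UNIV::'m set)}"
    then show "u \<circ> p \<circ> inv u \<in> {p. p permutes (UNIV::'n set)}"
      using u by (auto simp: bij_imp_bij_inv permutes_bij intro!: bij_comp bij_imp_permutes)
  qed (auto simp: iu fun_eq_iff)
  finally show ?thesis by (simp add: det_def)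
qed

text \<open>Conjugate \<open>\<tau>\<close> by the relabelling \<open>L\<close> onto the
  well-ordered index type, change variables there, and pull the result back along
  \<open>L\<close>.\<close>

lemma absolutely_integrable_change_of_variables_finite:
  fixes \<tau> :: "real^'n::finite \<Rightarrow> real^'n" and f :: "real^'n \<Rightarrow> real"
  assumes S: "open S" and \<tau>: "\<And>x. x \<in> S \<Longrightarrow> (\<tau> has_derivative \<tau>' x) (at x)" and inj: "inj_on \<tau> S"
    and f: "f absolutely_integrable_on (\<tau> ` S)"
  shows "(\<lambda>x. \<bar>det (matrix (\<tau>' x))\<bar> * f (\<tau> x)) absolutely_integrable_on S"
    and "integral S (\<lambda>x. \<bar>det (matrix (\<tau>' x))\<bar> * f (\<tau> x)) = integral (\<tau> ` S) f"
proof -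
  define L where "L = (reindex unordered :: real^'n \<Rightarrow> real^('n ordered))"
  define L' where "L' = (reindex (inv unordered) :: real^('n ordered) \<Rightarrow> real^'n)"
  have LL [simp]: "L' (L x) = x" "L (L' y) = y" for x y
    by (simp_all add: L_def L'_def reindex_inv bij_unordered)
  have lin: "linear L" "linear L'"
    by (simp_all add: L_def L'_def linear_reindex)
  define T where "T y = L (\<tau> (L' y))" for y
  define T' where "T' y v = L (\<tau>' (L' y) (L' v))" for y v
  have im: "T ` (L ` S) = L ` (\<tau> ` S)" "L' ` L ` (\<tau> ` S) = \<tau> ` S"
    by (auto simp: T_def image_image)
  have "bij (inv (unordered :: 'n ordered \<Rightarrow> 'n))"
    by (intro bij_imp_bij_inv bij_unordered)
  then have f1: "(\<lambda>y. f (L' y)) absolutely_integrable_on (T ` (L ` S))"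
    "integral (T ` (L ` S)) (\<lambda>y. f (L' y)) = integral (\<tau> ` S) f"
    using absolutely_integrable_reindex[where u = "inv (unordered :: 'n ordered \<Rightarrow> 'n)" and f = f
      and S = "L ` (\<tau> ` S)"] f
    unfolding L'_def[symmetric] im by auto
  have "L ` S = L' -` S"
    by (auto simp: image_iff) (metis LL(2))
  then have "open (L ` S)"
    using S lin by (simp add: open_vimage linear_continuous_on linear_conv_bounded_linear)
  then have leb: "L ` S \<in> sets lebesgue"
    by (simp add: borel_open lborelD)
  have der: "(T has_derivative T' y) (at y within L ` S)" if y: "y \<in> L ` S" for y
  proof -
    have L: "(L' has_derivative L') (at y)" "(L has_derivative L) (at (\<tau> (L' y)))"
      using lin by (simp_all add: linear_conv_bounded_linear bounded_linear_imp_has_derivative)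
    have "(\<tau> has_derivative \<tau>' (L' y)) (at (L' y))"
      using y by (auto intro: \<tau>)
    from has_derivative_compose[OF has_derivative_compose[OF L(1) this] L(2)] show ?thesis
      unfolding T_def[abs_def] T'_def[abs_def] by (rule has_derivative_at_withinI)
  qed
  have injT: "inj_on T (L ` S)"
    using inj by (auto simp: T_def inj_on_def dest!: arg_cong[where f = L'])
  \<comment> \<open>\<open>L\<close> carries the standard basis to the standard basis, so the two
    Jacobian matrices differ only by relabelling.\<close>
  have det: "det (matrix (T' (L x))) = det (matrix (\<tau>' x))" for x
  proof -
    have "L' (axis j 1) = axis (unordered j) 1" for j :: "'n ordered"
    proof -
      have "L (axis (unordered j) 1) = axis j 1"
        by (auto simp: L_def reindex_def vec_eq_iff axis_def ordered.expand)
      then show ?thesis by (metis LL(1))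
    qed
    then have "matrix (T' (L x)) = (\<chi> i j. matrix (\<tau>' x) $ unordered i $ unordered j)"
      by (simp add: matrix_def T'_def) (simp add: L_def reindex_def vec_eq_iff)
    then show ?thesis
      by (simp add: det_reindex bij_unordered)
  qed
  \<comment> \<open>The theorem applied here is about vector-valued integrands, hence the detour
    through \<open>real^1\<close>.\<close>
  have *: "(\<lambda>y. \<bar>det (matrix (T' y))\<bar> * f (L' (T y))) absolutely_integrable_on (L ` S)"
    "integral (L ` S) (\<lambda>y. \<bar>det (matrix (T' y))\<bar> * f (L' (T y))) = integral (\<tau> ` S) f"
    using f1 has_absolute_integral_change_of_variables
        [OF leb der injT, where f = "\<lambda>y. vec (f (L' y)) :: real^1" and b = "vec (integral (\<tau> ` S) f)"]
    by (simp_all add: absolutely_integrable_on_1_iff integral_on_1_eq)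
  show "(\<lambda>x. \<bar>det (matrix (\<tau>' x))\<bar> * f (\<tau> x)) absolutely_integrable_on S"
    "integral S (\<lambda>x. \<bar>det (matrix (\<tau>' x))\<bar> * f (\<tau> x)) = integral (\<tau> ` S) f"
    using absolutely_integrable_reindex[OF bij_unordered *(1)[unfolded L_def]] *(2)
    unfolding L_def[symmetric] by (simp_all add: det T_def)
qed

section \<open>The divergence in coordinates\<close>

text \<open>Nothing is known of \<open>f\<close> outside \<open>S\<close>, as for a coordinate
  expression outside its chart range. On \<open>S\<close> it may be replaced by its restriction to
  \<open>C\<close>.\<close>

lemma continuous_compact_support_absolutely_integrable:
  fixes f :: "'a::euclidean_space \<Rightarrow> real"
  assumes "continuous_on S f" "compact C" "C \<subseteq> S" "\<And>x. x \<in> S - C \<Longrightarrow> f x = 0"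
  shows "f absolutely_integrable_on S"
proof -
  have "integrable lborel (\<lambda>x. indicator C x *\<^sub>R f x)"
    using assms by (intro borel_integrable_compact) (auto intro: continuous_on_subset)
  then have "integrable lebesgue (\<lambda>x. indicator C x *\<^sub>R f x)"
    using integrable_completion[of "\<lambda>x. indicator C x *\<^sub>R f x" lborel] borel_measurable_integrable
    by blast
  moreover have "(\<lambda>x. indicator C x *\<^sub>R f x) = (\<lambda>x. indicator S x *\<^sub>R f x)"
    using assms by (auto simp: indicator_def fun_eq_iff)
  ultimately show ?thesis
    by (simp add: set_integrable_def)
qed

text \<open>Nonnegativity lets the integral over a small box around \<open>x\<close> be squeezed
  between 0 and the integral over \<open>S\<close>.\<close>

lemma integral_nonneg_continuous_eq_0D:
  fixes f :: "'a::euclidean_space \<Rightarrow> real"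
  assumes "open S" "continuous_on S f" "f integrable_on S" "integral S f = 0"
    and nn: "\<And>x. x \<in> S \<Longrightarrow> 0 \<le> f x" and x: "x \<in> S"
  shows "f x = 0"
proof -
  obtain a b where ab: "x \<in> box a b" "cbox a b \<subseteq> S"
    using assms(1) x by (metis open_contains_cbox)
  have cont: "continuous_on (cbox a b) f"
    using assms(2) ab(2) continuous_on_subset by blast
  then have int: "f integrable_on cbox a b"
    by (rule integrable_continuous)
  have "integral (cbox a b) f \<le> 0"
    using integral_subset_le[OF ab(2) int assms(3)] nn assms(4) by auto
  moreover have "integral (cbox a b) f \<ge> 0"
    using int ab nn by (intro integral_nonneg) auto
  ultimately have "(f has_integral 0) (cbox a b)"
    using int by (metis antisym has_integral_integral)
  then show ?thesis
    using ab nn by (intro has_integral_0_cbox_imp_0[OF cont]) (use box_subset_cbox[of a b] in auto)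
qed

lemma frechet_derivative_eq:
  assumes "(f has_derivative f') (at x)"
  shows "frechet_derivative f (at x) = f'"
  using frechet_derivative_at[OF assms] by simp

lemma jacobian_works_at:
  fixes f :: "real^'n::finite \<Rightarrow> real^'m::finite"
  assumes "(f has_derivative f') (at x)"
  shows "jacobian f (at x) *v v = f' v"
  using assms has_derivative_linear[OF assms]
  by (simp add: jacobian_def frechet_derivative_eq[OF assms] matrix_works)

lemma linear_sum_axis:
  fixes L :: "real^'n::finite \<Rightarrow> 'b::real_vector"
  assumes "linear L"
  shows "(\<Sum>k\<in>UNIV. v $ k *\<^sub>R L (axis k 1)) = L v"
proof -
  have "L v = L (\<Sum>k\<in>UNIV. v $ k *\<^sub>R axis k 1)"
    by (simp add: basis_expansion scalar_mult_eq_scaleR[symmetric])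
  also have "\<dots> = (\<Sum>k\<in>UNIV. v $ k *\<^sub>R L (axis k 1))"
    using assms by (simp add: linear_sum linear_cmul)
  finally show ?thesis by simp
qed

text \<open>Jacobi's formula for the volume density; the factor 1/2 comes from the square
  root.\<close>

lemma has_derivative_sqrt_det:
  fixes G :: "real^'n::finite \<Rightarrow> real^'m::finite^'m"
  assumes G: "(G has_derivative G') (at x)" and pos: "det (G x) > 0"
  shows "((\<lambda>y. sqrt (det (G y))) has_derivative
    (\<lambda>v. sqrt (det (G x)) * trace (matrix_inv (G x) ** G' v) / 2)) (at x)"
proof -
  have "((\<lambda>y. det (G y)) has_derivative (\<lambda>v. det (G x) * trace (matrix_inv (G x) ** G' v))) (at x)"
    using pos by (intro has_derivative_compose[OF G has_derivative_det]) (simp add: invertible_det_nz)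
  then have "((\<lambda>y. sqrt (det (G y))) has_derivative
      (\<lambda>v. (det (G x) * trace (matrix_inv (G x) ** G' v)) * (inverse (sqrt (det (G x))) / 2))) (at x)"
    using pos by (rule has_derivative_real_sqrt[rotated])
  moreover have "(det (G x) * t) * (inverse (sqrt (det (G x))) / 2) = sqrt (det (G x)) * t / 2" for t
    using pos real_sqrt_mult_self[of "det (G x)"] by (simp add: field_simps)
  ultimately show ?thesis by (simp only:)
qed

text \<open>Jacobi's formula turns the trace of the conformal Killing equation into a formula for
  the divergence with respect to the volume density.\<close>

lemma divergence_of_conformal_field:
  fixes G :: "real^'n::finite \<Rightarrow> real^'n^'n" and Y :: "real^'n \<Rightarrow> real^'n"
  assumes G: "(G has_derivative G') (at x)" and Y: "(Y has_derivative Y') (at x)"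
    and pos: "det (G x) > 0"
    and conf: "\<And>i j. (\<Sum>k\<in>UNIV. Y x $ k * pd k (\<lambda>y. G y $ i $ j) x
        + pd i (\<lambda>y. Y y $ k) x * G x $ k $ j + pd j (\<lambda>y. Y y $ k) x * G x $ i $ k)
        = 2 * (F * G x $ i $ j)"
  shows "(\<Sum>i\<in>UNIV. frechet_derivative (\<lambda>y. sqrt (det (G y)) * Y y $ i) (at x) (axis i 1))
    = real CARD('n) * F * sqrt (det (G x))"
proof -
  define J where "J = matrix Y'"
  define w where "w = sqrt (det (G x))"
  define T where "T v = trace (matrix_inv (G x) ** G' v)" for v
  have lin: "linear G'" "linear Y'"
    using G Y has_derivative_linear by auto
  have inv: "matrix_inv (G x) ** G x = mat 1" "G x ** matrix_inv (G x) = mat 1"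
    using pos by (simp_all add: invertible_matrix_inv invertible_det_nz)
  have linTr: "linear (\<lambda>H. trace (matrix_inv (G x) ** H))"
    by (rule linearI)
      (simp_all add: matrix_add_ldistrib trace_add matrix_scalar_ac trace_def sum_distrib_left
        sum.distrib flip: scalar_matrix_assoc)
  have pdG: "pd k (\<lambda>y. G y $ i $ j) x = G' (axis k 1) $ i $ j" for i j k
    unfolding pd_def
    by (subst frechet_derivative_eq) (auto intro!: derivative_eq_intros G bounded_linear.has_derivative[OF bounded_linear_vec_nth])
  have pdY: "pd i (\<lambda>y. Y y $ k) x = J $ k $ i" for i k
    unfolding pd_def
    by (subst frechet_derivative_eq[where f' = "\<lambda>v. Y' v $ k"])
      (auto intro!: derivative_eq_intros Y bounded_linear.has_derivative[OF bounded_linear_vec_nth] simp: J_def matrix_def)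
  \<comment> \<open>The hypothesis \<open>conf\<close> in matrix form: its first term is the
    derivative of \<open>G\<close> in the direction \<open>Y x\<close>, the other two are products
    of \<open>G x\<close> with the Jacobian \<open>J\<close> of \<open>Y\<close>.\<close>
  have "G' (Y x) = (2 * F) *\<^sub>R G x - transpose J ** G x - G x ** J"
  proof -
    have "G' (Y x) $ i $ j = 2 * F * G x $ i $ j - (transpose J ** G x) $ i $ j - (G x ** J) $ i $ j" for i j
    proof -
      have "G' (Y x) $ i $ j = (\<Sum>k\<in>UNIV. Y x $ k *\<^sub>R G' (axis k 1)) $ i $ j"
        by (simp add: linear_sum_axis lin)
      then show ?thesis
        using conf[of i j]
        by (simp add: pdG pdY sum.distrib matrix_matrix_mult_def transpose_def mult.commute)
    qed
    then show ?thesis by (simp add: vec_eq_iff)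
  qed
  moreover have "trace (matrix_inv (G x) ** (transpose J ** G x)) = trace (transpose J)"
    by (metis inv(2) matrix_mul_assoc matrix_mul_rid trace_mul_sym)
  then have "trace (matrix_inv (G x) ** (transpose J ** G x)) = trace J"
    by (simp add: trace_def transpose_def)
  moreover have "trace (matrix_inv (G x) ** (G x ** J)) = trace J"
    by (metis inv(1) matrix_mul_assoc matrix_mul_lid)
  \<comment> \<open>Trace against the inverse metric: \<open>G x\<close> contributes the dimension,
    and each Jacobian term contributes \<open>trace J\<close>.\<close>
  ultimately have TX: "T (Y x) = 2 * real CARD('n) * F - 2 * trace J"
    using linear_diff[OF linTr] linear_cmul[OF linTr] by (simp add: T_def inv trace_I)
  have linT: "linear T"
    unfolding T_def using linear_compose[OF lin(1) linTr] by (simp add: o_def)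
  have "frechet_derivative (\<lambda>y. sqrt (det (G y)) * Y y $ i) (at x) (axis i 1)
      = w * J $ i $ i + Y x $ i *\<^sub>R T (axis i 1) * (w / 2)" for i
  proof -
    have "((\<lambda>y. sqrt (det (G y)) * Y y $ i) has_derivative
        (\<lambda>v. sqrt (det (G x)) * Y' v $ i + (w * T v / 2) * Y x $ i)) (at x)"
      unfolding w_def T_def
      by (intro has_derivative_mult has_derivative_sqrt_det G pos
          bounded_linear.has_derivative[OF bounded_linear_vec_nth] Y)
    then show ?thesis
      by (simp add: frechet_derivative_eq J_def matrix_def w_def mult_ac)
  qed
  \<comment> \<open>The product rule leaves \<open>w * trace J\<close> plus half of
    \<open>w * T (Y x)\<close>; inserting \<open>TX\<close> cancels the traces of
    \<open>J\<close>.\<close>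
  then have "(\<Sum>i\<in>UNIV. frechet_derivative (\<lambda>y. sqrt (det (G y)) * Y y $ i) (at x) (axis i 1))
      = w * trace J + (\<Sum>i\<in>UNIV. Y x $ i *\<^sub>R T (axis i 1)) * (w / 2)"
    by (simp add: sum.distrib sum_distrib_left sum_distrib_right trace_def)
  also have "\<dots> = w * trace J + T (Y x) * (w / 2)"
    by (subst linear_sum_axis[OF linT]) simp
  finally show ?thesis
    by (simp add: TX w_def algebra_simps)
qed

section \<open>Charts\<close>

lemma homeomorphic_map_coord:
  "is_chart M c \<Longrightarrow> homeomorphic_map (subtopology M (chart_dom c)) (top_of_set (chart_ran c)) (coord c)"
  by (simp add: is_chart_def)

lemma openin_chart_dom: "is_chart M c \<Longrightarrow> openin M (chart_dom c)"
  by (simp add: is_chart_def)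

lemma open_chart_ran: "is_chart M c \<Longrightarrow> open (chart_ran c)"
  by (simp add: is_chart_def)

lemma chart_dom_subset: "is_chart M c \<Longrightarrow> chart_dom c \<subseteq> topspace M"
  by (simp add: openin_chart_dom openin_subset)

lemma topspace_chart: "is_chart M c \<Longrightarrow> topspace (subtopology M (chart_dom c)) = chart_dom c"
  by (simp add: chart_dom_subset inf.absorb2)

lemma param_coord:
  assumes "is_chart M c" "p \<in> chart_dom c"
  shows "param c (coord c p) = p"
proof -
  have "inj_on (coord c) (chart_dom c)"
    using homeomorphic_imp_injective_map[OF homeomorphic_map_coord[OF assms(1)]]
    by (simp add: topspace_chart assms del: topspace_subtopology)
  then show ?thesis
    by (simp add: param_def assms)
qed

lemma coord_in_chart_ran: "p \<in> chart_dom c \<Longrightarrow> coord c p \<in> chart_ran c"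
  by (simp add: chart_ran_def)

lemma coord_param: "x \<in> chart_ran c \<Longrightarrow> coord c (param c x) = x"
  by (simp add: chart_ran_def param_def f_inv_into_f)

lemma param_in_chart_dom: "x \<in> chart_ran c \<Longrightarrow> param c x \<in> chart_dom c"
  by (simp add: chart_ran_def param_def inv_into_into)

lemma open_coord_image:
  assumes c: "is_chart M c" and U: "openin M U"
  shows "open (coord c ` (chart_dom c \<inter> U))"
proof -
  have "openin (subtopology M (chart_dom c)) (chart_dom c \<inter> U)"
    using U by (metis inf_commute openin_subtopology_Int2)
  then have "openin (top_of_set (chart_ran c)) (coord c ` (chart_dom c \<inter> U))"
    using homeomorphic_map_coord[OF c] homeomorphic_map_openness_eq by blast
  then show ?thesis
    using open_chart_ran[OF c] openin_open_trans by blast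
qed

lemma coord_param_image: "V \<subseteq> chart_ran c \<Longrightarrow> coord c ` param c ` V = V"
  by (force simp: coord_param image_iff)

lemma param_image_subset: "V \<subseteq> chart_ran c \<Longrightarrow> param c ` V \<subseteq> chart_dom c"
  using param_in_chart_dom by blast

lemma openin_param_image:
  assumes c: "is_chart M c" and V: "open V" "V \<subseteq> chart_ran c"
  shows "openin M (param c ` V)"
proof -
  have "openin (top_of_set (chart_ran c)) (coord c ` param c ` V)"
    using V by (simp add: coord_param_image open_subset)
  then have "openin (subtopology M (chart_dom c)) (param c ` V)"
    using homeomorphic_map_openness[OF homeomorphic_map_coord[OF c]] param_image_subset[OF V(2)]
      topspace_chart[OF c] by blast
  then show ?thesis
    using openin_chart_dom[OF c] openin_trans_full by blast
qed

lemma compactin_param_image: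
  assumes c: "is_chart M c" and C: "compact C" "C \<subseteq> chart_ran c"
  shows "compactin M (param c ` C)"
proof -
  have "compactin (top_of_set (chart_ran c)) (coord c ` param c ` C)"
    using C by (simp add: coord_param_image compactin_subtopology)
  then have "compactin (subtopology M (chart_dom c)) (param c ` C)"
    using homeomorphic_map_compactness[OF homeomorphic_map_coord[OF c]] param_image_subset[OF C(2)]
      topspace_chart[OF c] by blast
  then show ?thesis
    by (simp add: compactin_subtopology)
qed

lemma overlap_iff:
  assumes "is_chart M c"
  shows "x \<in> overlap c d \<longleftrightarrow> x \<in> chart_ran c \<and> param c x \<in> chart_dom d"
proof
  assume "x \<in> overlap c d"
  then obtain p where "p \<in> chart_dom c" "p \<in> chart_dom d" "x = coord c p"
    by (auto simp: overlap_def)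
  then show "x \<in> chart_ran c \<and> param c x \<in> chart_dom d"
    using assms by (simp add: param_coord coord_in_chart_ran)
next
  assume "x \<in> chart_ran c \<and> param c x \<in> chart_dom d"
  then show "x \<in> overlap c d"
    unfolding overlap_def by (metis IntI coord_param image_eqI param_in_chart_dom)
qed

lemma open_overlap:
  assumes "is_chart M c" "is_chart M d"
  shows "open (overlap c d)"
  unfolding overlap_def using open_coord_image[OF assms(1) openin_chart_dom[OF assms(2)]] .

lemma transition_image_overlap:
  assumes "is_chart M c" "is_chart M d"
  shows "transition c d ` overlap c d = overlap d c"
  unfolding overlap_def image_image transition_def
  using assms by (force simp: param_coord image_iff)

lemma param_transition:
  assumes "is_chart M c" "is_chart M d" "x \<in> overlap c d"
  shows "param d (transition c d x) = param c x"
  using assms by (simp add: transition_def overlap_iff param_coord)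

lemma inj_on_transition:
  assumes "is_chart M c" "is_chart M d"
  shows "inj_on (transition c d) (overlap c d)"
  by (rule inj_onI) (metis assms coord_param overlap_iff param_transition)

section \<open>The divergence theorem on a compact Riemannian manifold\<close>

locale riemannian_mfd =
  fixes M :: "'a topology" and A :: "('a, 'n::finite) chart set" and g :: "('a, 'n) tensor2"
  assumes riemannian: "riemannian_manifold M A g"
begin

lemma atlas_chart: "c \<in> A \<Longrightarrow> is_chart M c"
  using riemannian by (simp add: riemannian_manifold_def smooth_manifold_def)

lemma Hausdorff: "Hausdorff_space M"
  using riemannian by (simp add: riemannian_manifold_def smooth_manifold_def)

lemma atlas_covers: "p \<in> topspace M \<Longrightarrow> \<exists>c\<in>A. p \<in> chart_dom c"
  using riemannian unfolding riemannian_manifold_def smooth_manifold_def by blast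

lemma param_in_topspace: "c \<in> A \<Longrightarrow> x \<in> chart_ran c \<Longrightarrow> param c x \<in> topspace M"
  using atlas_chart chart_dom_subset param_in_chart_dom by blast

lemma C1_on_transition: "c \<in> A \<Longrightarrow> d \<in> A \<Longrightarrow> C1_on (overlap c d) (transition c d)"
  using riemannian
  by (auto simp: riemannian_manifold_def smooth_manifold_def intro!: smooth_on_imp_C1_on)

lemma C1_on_metric: "c \<in> A \<Longrightarrow> C1_on (chart_ran c) (g c)"
  using riemannian
  by (auto simp: riemannian_manifold_def riemannian_metric_def intro!: smooth_on_imp_C1_on)

lemma metric_pos: "c \<in> A \<Longrightarrow> x \<in> chart_ran c \<Longrightarrow> v \<noteq> 0 \<Longrightarrow> v \<bullet> (g c x *v v) > 0"
  using riemannian by (simp add: riemannian_manifold_def riemannian_metric_def)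

lemma det_metric_pos: "c \<in> A \<Longrightarrow> x \<in> chart_ran c \<Longrightarrow> det (g c x) > 0"
  by (rule posdef_det_pos) (rule metric_pos)

definition vol :: "('a, 'n) chart \<Rightarrow> real^'n \<Rightarrow> real"
  where "vol c x = sqrt (det (g c x))"

lemma vol_pos: "c \<in> A \<Longrightarrow> x \<in> chart_ran c \<Longrightarrow> vol c x > 0"
  by (simp add: vol_def det_metric_pos)

lemma C1_on_vol: "c \<in> A \<Longrightarrow> C1_on (chart_ran c) (vol c)"
  unfolding vol_def[abs_def]
  by (rule C1_on_compose[OF C1_on_sqrt C1_on_det[OF C1_on_metric]]) (auto simp: det_metric_pos)

text \<open>Determinants in the transformation law of the metric produce the square of the Jacobian
  determinant, and its root is an absolute value. This is exactly the factor in the change of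
  variables formula.\<close>

lemma vol_transition:
  assumes "c \<in> A" "d \<in> A" "x \<in> overlap c d"
  shows "vol c x = \<bar>det (jacobian (transition c d) (at x))\<bar> * vol d (transition c d x)"
proof -
  have "g c x = transpose (jacobian (transition c d) (at x)) ** g d (transition c d x)
               ** jacobian (transition c d) (at x)"
    using riemannian assms unfolding riemannian_manifold_def riemannian_metric_def by blast
  then have "det (g c x) = (det (jacobian (transition c d) (at x)))\<^sup>2 * det (g d (transition c d x))"
    by (simp add: det_mul det_transpose power2_eq_square)
  then show ?thesis
    by (simp add: vol_def real_sqrt_mult)
qed

section \<open>C^1 functions on the manifold, bumps and partitions of unity\<close>

definition C1_fun :: "('a \<Rightarrow> real) \<Rightarrow> bool"
  where "C1_fun u \<longleftrightarrow> (\<forall>c\<in>A. C1_on (chart_ran c) (\<lambda>x. u (param c x)))"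

lemma C1_funD: "C1_fun u \<Longrightarrow> c \<in> A \<Longrightarrow> C1_on (chart_ran c) (\<lambda>x. u (param c x))"
  by (simp add: C1_fun_def)

text \<open>Positive exactly on a coordinate ball, and C^1 across its boundary because of the outer
  square.\<close>

definition bump :: "('a, 'n) chart \<Rightarrow> real^'n \<Rightarrow> real \<Rightarrow> 'a \<Rightarrow> real"
  where "bump c x0 r p =
    (if p \<in> chart_dom c then (max 0 (r\<^sup>2 - (coord c p - x0) \<bullet> (coord c p - x0)))\<^sup>2 else 0)"

lemma bump_nonneg: "bump c x0 r p \<ge> 0"
  by (simp add: bump_def)

lemma bump_pos_iff:
  assumes "r > 0"
  shows "bump c x0 r p > 0 \<longleftrightarrow> p \<in> chart_dom c \<and> coord c p \<in> ball x0 r"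
proof -
  have "r\<^sup>2 - (y - x0) \<bullet> (y - x0) > 0 \<longleftrightarrow> y \<in> ball x0 r" for y :: "real^'n"
    using assms by (simp add: dist_norm norm_minus_commute dot_square_norm abs_le_square_iff
        flip: not_le)
  moreover have "(max 0 t)\<^sup>2 > 0 \<longleftrightarrow> t > 0" for t :: real
    by (auto simp: max_def)
  ultimately show ?thesis
    unfolding bump_def by (simp del: mem_ball)
qed

lemma bump_support:
  assumes "c \<in> A" "r > 0" "bump c x0 r p \<noteq> 0"
  shows "p \<in> param c ` cball x0 r"
proof (rule image_eqI)
  have *: "p \<in> chart_dom c \<and> coord c p \<in> ball x0 r"
    using assms bump_nonneg[of c x0 r p] bump_pos_iff[OF assms(2), of c x0 p] by linarith
  then show "p = param c (coord c p)"
    using assms(1) by (simp add: param_coord[OF atlas_chart])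
  show "coord c p \<in> cball x0 r"
    using * ball_subset_cball by blast
qed

text \<open>Inside the domain of \<open>c\<close> the bump is a C^1 function of the coordinates of
  \<open>c\<close>, pulled back by a transition map. At any other point it is 0 nearby: the image
  \<open>K\<close> of the closed ball is compact, hence closed in a Hausdorff space, and its
  complement is a neighbourhood.\<close>

lemma C1_fun_bump:
  assumes c: "c \<in> A" and r: "r > 0" "cball x0 r \<subseteq> chart_ran c"
  shows "C1_fun (bump c x0 r)"
  unfolding C1_fun_def
proof (intro ballI C1_on_local)
  fix d x assume d: "d \<in> A" and x: "x \<in> chart_ran d"
  define b where "b y = (max 0 (r\<^sup>2 - (y - x0) \<bullet> (y - x0)))\<^sup>2" for y :: "real^'n"
  have b: "C1_on UNIV b"
    unfolding b_def
  proof (rule C1_on_compose[OF C1_on_square_max])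
    show "C1_on UNIV (\<lambda>y. r\<^sup>2 - (y - x0) \<bullet> (y - x0))"
    proof (rule C1_onI)
      show "((\<lambda>y. r\<^sup>2 - (y - x0) \<bullet> (y - x0)) has_derivative
          blinfun_apply (- 2 *\<^sub>R blinfun_inner_left (y - x0))) (at y)" for y
        by (auto intro!: derivative_eq_intros
            simp: blinfun.minus_left blinfun.scaleR_left inner_commute)
      show "continuous_on UNIV (\<lambda>y. - 2 *\<^sub>R blinfun_inner_left (y - x0))"
        by (intro continuous_intros)
    qed
  qed auto
  show "\<exists>U. open U \<and> x \<in> U \<and> C1_on U (\<lambda>x. bump c x0 r (param d x))"
  proof (cases "param d x \<in> chart_dom c")
    case True
    then have "x \<in> overlap d c"
      by (simp add: overlap_iff[OF atlas_chart] d x)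
    moreover have op: "open (overlap d c)"
      using c d by (meson atlas_chart open_overlap)
    moreover have "C1_on (overlap d c) (\<lambda>x. b (transition d c x))"
      by (rule C1_on_compose[OF b C1_on_transition]) (use c d in auto)
    then have "C1_on (overlap d c) (\<lambda>x. bump c x0 r (param d x))"
      by (rule C1_on_cong_open[OF _ op])
        (auto simp: overlap_iff[OF atlas_chart[OF d]] transition_def b_def bump_def)
    ultimately show ?thesis by blast
  next
    case False
    define K where "K = param c ` cball x0 r"
    define U where "U = coord d ` (chart_dom d \<inter> (topspace M - K))"
    have "compactin M K"
      unfolding K_def using atlas_chart[OF c] r by (intro compactin_param_image) auto
    then have "openin M (topspace M - K)"
      using Hausdorff compactin_imp_closedin by blast
    then have op: "open U"
      unfolding U_def using atlas_chart[OF d] open_coord_image by blast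
    have "K \<subseteq> chart_dom c"
      unfolding K_def by (rule param_image_subset[OF r(2)])
    then have "param d x \<notin> K"
      using False by blast
    then have "x \<in> U"
      unfolding U_def using x d by (intro image_eqI[of _ _ "param d x"])
        (auto simp: coord_param param_in_chart_dom param_in_topspace)
    moreover have "bump c x0 r (param d y) = 0" if "y \<in> U" for y
    proof -
      have "param d y \<notin> K"
        using that param_coord[OF atlas_chart[OF d]] unfolding U_def by auto
      then show ?thesis
        unfolding K_def using bump_support[OF c r(1)] by blast
    qed
    then have "C1_on U (\<lambda>x. bump c x0 r (param d x))"
      by (intro C1_on_cong_open[OF C1_on_const[of _ 0] op]) simp
    ultimately show ?thesis
      using op by blast
  qed
qed

text \<open>The indices in \<open>Q\<close> are points serving as labels. The compact sets
  \<open>C p\<close> are recorded in coordinates, where integration by parts needs them.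
  Nonnegativity and the support condition range over the whole type, so each \<open>\<psi> p\<close>
  vanishes off the domain of \<open>c p\<close>, even outside \<open>topspace M\<close>.\<close>

definition partition_of_unity ::
    "'a set \<Rightarrow> ('a \<Rightarrow> ('a, 'n) chart) \<Rightarrow> ('a \<Rightarrow> (real^'n) set) \<Rightarrow> ('a \<Rightarrow> 'a \<Rightarrow> real) \<Rightarrow> bool"
  where "partition_of_unity Q c C \<psi> \<longleftrightarrow> finite Q \<and>
    (\<forall>p\<in>Q. c p \<in> A \<and> compact (C p) \<and> C p \<subseteq> chart_ran (c p) \<and> C1_fun (\<psi> p) \<and>
      (\<forall>q. 0 \<le> \<psi> p q \<and> (\<psi> p q \<noteq> 0 \<longrightarrow> q \<in> param (c p) ` C p))) \<and>
    (\<forall>q\<in>topspace M. (\<Sum>p\<in>Q. \<psi> p q) = 1)"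

lemma exists_partition_of_unity:
  assumes "compact_space M"
  obtains Q c C \<psi> where "partition_of_unity Q c C \<psi>"
proof -
  have "\<exists>c r. c \<in> A \<and> p \<in> chart_dom c \<and> r > 0 \<and> cball (coord c p) r \<subseteq> chart_ran c"
    if "p \<in> topspace M" for p
    using that by (meson atlas_chart atlas_covers coord_in_chart_ran open_chart_ran open_contains_cball)
  then obtain c r where cr: "\<And>p. p \<in> topspace M \<Longrightarrow> c p \<in> A \<and> p \<in> chart_dom (c p) \<and> r p > 0
      \<and> cball (coord (c p) p) (r p) \<subseteq> chart_ran (c p)"
    by metis
  define V where "V p = param (c p) ` ball (coord (c p) p) (r p)" for p
  have V: "openin M (V p)" "p \<in> V p" if "p \<in> topspace M" for p
  proof -
    show "openin M (V p)"
      unfolding V_def using cr[OF that] ball_subset_cball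
      by (intro openin_param_image[OF atlas_chart]) (auto intro: order_trans)
    show "p \<in> V p"
      unfolding V_def using cr[OF that] param_coord[OF atlas_chart]
      by (intro image_eqI[of _ _ "coord (c p) p"]) auto
  qed
  have "\<forall>U\<in>V ` topspace M. openin M U" "topspace M \<subseteq> \<Union> (V ` topspace M)"
    using V by auto
  then obtain F where F: "finite F" "F \<subseteq> V ` topspace M" "topspace M \<subseteq> \<Union> F"
    using assms unfolding compact_space_alt by meson
  then obtain Q where Q: "finite Q" "Q \<subseteq> topspace M" "F = V ` Q"
    by (meson finite_subset_image)
  define \<phi> where "\<phi> p = bump (c p) (coord (c p) p) (r p)" for p
  define S where "S q = (\<Sum>p\<in>Q. \<phi> p q)" for q
  \<comment> \<open>The sets \<open>V p\<close> of the finite subcover are the positivity sets of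
    the bumps, so the normalising divisor has no zero on \<open>M\<close>.\<close>
  have S: "S q > 0" if q: "q \<in> topspace M" for q
  proof -
    obtain p where p: "p \<in> Q" "q \<in> V p"
      using F Q q by auto
    then have p': "p \<in> topspace M" using Q by auto
    have "\<phi> p q > 0"
    proof -
      obtain x where x: "x \<in> ball (coord (c p) p) (r p)" "q = param (c p) x"
        using p(2) by (auto simp: V_def)
      then have "x \<in> chart_ran (c p)"
        using cr[OF p'] ball_subset_cball by blast
      then show ?thesis
        using x cr[OF p'] by (simp add: \<phi>_def bump_pos_iff coord_param param_in_chart_dom)
    qed
    then show ?thesis
      unfolding S_def using p(1) Q(1) by (intro sum_pos2[of _ p]) (auto simp: \<phi>_def bump_nonneg)
  qed
  have \<phi>C1: "C1_fun (\<phi> p)" if "p \<in> Q" for p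
    unfolding \<phi>_def using cr[of p] that Q by (intro C1_fun_bump) auto
  have \<psi>C1: "C1_fun (\<lambda>q. \<phi> p q * inverse (S q))" if p: "p \<in> Q" for p
    unfolding C1_fun_def
  proof
    fix d assume d: "d \<in> A"
    have "C1_on (chart_ran d) (\<lambda>x. S (param d x))"
      unfolding S_def by (intro C1_on_sum C1_funD \<phi>C1 d)
    then have "C1_on (chart_ran d) (\<lambda>x. inverse (S (param d x)))"
      by (rule C1_on_compose[OF C1_on_inverse]) (auto intro!: S param_in_topspace d)
    then show "C1_on (chart_ran d) (\<lambda>x. \<phi> p (param d x) * inverse (S (param d x)))"
      by (rule C1_on_mult[OF C1_funD[OF \<phi>C1[OF p] d]])
  qed
  have "partition_of_unity Q c (\<lambda>p. cball (coord (c p) p) (r p)) (\<lambda>p q. \<phi> p q * inverse (S q))"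
    unfolding partition_of_unity_def
  proof (intro conjI ballI allI impI)
    show "(\<Sum>p\<in>Q. \<phi> p q * inverse (S q)) = 1" if "q \<in> topspace M" for q
      using S[OF that] by (simp add: S_def flip: sum_distrib_right)
    \<comment> \<open>Here \<open>q\<close> may lie off the manifold, where \<open>S q\<close> and
      therefore its \<open>inverse\<close> are 0.\<close>
    show "0 \<le> \<phi> p q * inverse (S q)" if "p \<in> Q" for p q
      by (auto simp: S_def \<phi>_def bump_nonneg sum_nonneg)
    show "q \<in> param (c p) ` cball (coord (c p) p) (r p)" if "p \<in> Q" "\<phi> p q * inverse (S q) \<noteq> 0" for p q
      using that Q cr[of p] unfolding \<phi>_def by (intro bump_support) auto
  qed (use Q cr \<psi>C1 in auto)
  then show thesis
    by (rule that)
qed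

section \<open>Integrals in one chart against the Riemannian density\<close>

definition chart_integrable :: "('a, 'n) chart \<Rightarrow> ('a \<Rightarrow> real) \<Rightarrow> bool"
  where "chart_integrable c u \<longleftrightarrow> (\<lambda>x. u (param c x) * vol c x) absolutely_integrable_on chart_ran c"

definition chart_integral :: "('a, 'n) chart \<Rightarrow> ('a \<Rightarrow> real) \<Rightarrow> real"
  where "chart_integral c u = integral (chart_ran c) (\<lambda>x. u (param c x) * vol c x)"

lemma chart_integral_sum:
  assumes "\<And>i. i \<in> I \<Longrightarrow> chart_integrable c (u i)"
  shows "chart_integral c (\<lambda>p. \<Sum>i\<in>I. u i p) = (\<Sum>i\<in>I. chart_integral c (u i))"
proof (cases "finite I")
  case True
  have "(\<lambda>x. u i (param c x) * vol c x) integrable_on chart_ran c" if "i \<in> I" for i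
    using assms[OF that] by (simp add: chart_integrable_def absolutely_integrable_on_def)
  then show ?thesis
    unfolding chart_integral_def sum_distrib_right
    by (intro integral_sum True) auto
qed (simp add: chart_integral_def)

lemma chart_integral_restrict_overlap:
  assumes c: "c \<in> A" and u: "{p. u p \<noteq> 0} \<subseteq> chart_dom c \<inter> chart_dom d"
  shows "chart_integrable c u \<longleftrightarrow>
      (\<lambda>x. u (param c x) * vol c x) absolutely_integrable_on overlap c d"
    and "chart_integral c u = integral (overlap c d) (\<lambda>x. u (param c x) * vol c x)"
proof -
  have eq: "(\<lambda>x. if x \<in> chart_ran c then u (param c x) * vol c x else 0)
      = (\<lambda>x. if x \<in> overlap c d then u (param c x) * vol c x else 0)"
    using u overlap_iff[OF atlas_chart[OF c]] by (auto simp: fun_eq_iff)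
  show "chart_integrable c u \<longleftrightarrow>
      (\<lambda>x. u (param c x) * vol c x) absolutely_integrable_on overlap c d"
    unfolding chart_integrable_def
    by (subst (1 2) absolutely_integrable_restrict_UNIV[symmetric]) (simp only: eq)
  show "chart_integral c u = integral (overlap c d) (\<lambda>x. u (param c x) * vol c x)"
    unfolding chart_integral_def
    by (subst (1 2) Henstock_Kurzweil_Integration.integral_restrict_UNIV[symmetric]) (simp only: eq)
qed

text \<open>The support condition reduces both integrals to the overlap. There the Jacobian factor
  of the substitution is absorbed by \<open>vol_transition\<close>.\<close>

lemma chart_integral_change:
  assumes c: "c \<in> A" and d: "d \<in> A" and u: "{p. u p \<noteq> 0} \<subseteq> chart_dom c \<inter> chart_dom d"
    and int: "chart_integrable d u"
  shows "chart_integrable c u" "chart_integral c u = chart_integral d u"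
proof -
  let ?\<tau> = "transition c d"
  note cd = atlas_chart[OF c] atlas_chart[OF d]
  have im: "?\<tau> ` overlap c d = overlap d c"
    by (rule transition_image_overlap[OF cd])
  have u': "{p. u p \<noteq> 0} \<subseteq> chart_dom d \<inter> chart_dom c"
    using u by blast
  note res_c = chart_integral_restrict_overlap[OF c u] and res_d = chart_integral_restrict_overlap[OF d u']
  have "(\<lambda>x. u (param d x) * vol d x) absolutely_integrable_on (?\<tau> ` overlap c d)"
    using int res_d(1) by (simp add: im)
  moreover have "(?\<tau> has_derivative frechet_derivative ?\<tau> (at x)) (at x)" if "x \<in> overlap c d" for x
    using that C1_on_has_frechet_derivative[OF C1_on_transition[OF c d]] by blast
  ultimately have *: "(\<lambda>x. \<bar>det (matrix (frechet_derivative ?\<tau> (at x)))\<bar> *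
        (u (param d (?\<tau> x)) * vol d (?\<tau> x))) absolutely_integrable_on overlap c d"
    "integral (overlap c d) (\<lambda>x. \<bar>det (matrix (frechet_derivative ?\<tau> (at x)))\<bar> *
        (u (param d (?\<tau> x)) * vol d (?\<tau> x))) = integral (overlap d c) (\<lambda>x. u (param d x) * vol d x)"
    using absolutely_integrable_change_of_variables_finite[OF open_overlap[OF cd] _ inj_on_transition[OF cd],
        where \<tau>' = "\<lambda>x. frechet_derivative ?\<tau> (at x)" and f = "\<lambda>x. u (param d x) * vol d x"]
    unfolding im by blast+
  have eq: "\<bar>det (matrix (frechet_derivative ?\<tau> (at x)))\<bar> * (u (param d (?\<tau> x)) * vol d (?\<tau> x))
      = u (param c x) * vol c x" if "x \<in> overlap c d" for x
    using vol_transition[OF c d that] param_transition[OF cd that] by (simp add: jacobian_def)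
  \<comment> \<open>Spiking over the empty set acts as a congruence rule for absolute
    integrability.\<close>
  show "chart_integrable c u"
    unfolding res_c(1) using *(1)
    by (rule absolutely_integrable_spike[where S = "{}"]) (auto simp: eq)
  show "chart_integral c u = chart_integral d u"
    using *(2) unfolding res_c(2) res_d(2) by (metis (no_types, lifting) eq integral_cong)
qed

section \<open>Derivatives along a vector field, divergence, integration by parts\<close>

definition deriv_along :: "('a, 'n) vfield \<Rightarrow> ('a \<Rightarrow> real) \<Rightarrow> 'a \<Rightarrow> real"
  where "deriv_along X u p = (let c = SOME c. c \<in> A \<and> p \<in> chart_dom c in
    frechet_derivative (\<lambda>x. u (param c x)) (at (coord c p)) (X c (coord c p)))"

text \<open>Frees \<open>deriv_along\<close> from its arbitrary choice of chart: the Jacobian from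
  the chain rule for \<open>u\<close> is the one by which the components of \<open>X\<close>
  transform.\<close>

lemma deriv_along_param:
  assumes X: "smooth_vector_field A X" and u: "C1_fun u" and c: "c \<in> A" and x: "x \<in> chart_ran c"
  shows "deriv_along X u (param c x) = frechet_derivative (\<lambda>x. u (param c x)) (at x) (X c x)"
proof -
  define d where "d = (SOME d. d \<in> A \<and> param c x \<in> chart_dom d)"
  have "d \<in> A \<and> param c x \<in> chart_dom d"
    unfolding d_def by (rule someI[of _ c]) (simp add: c x param_in_chart_dom)
  then have d: "d \<in> A" and xo: "x \<in> overlap c d"
    by (auto simp: overlap_iff[OF atlas_chart[OF c]] x)
  note cd = atlas_chart[OF c] atlas_chart[OF d]
  define y where "y = transition c d x"
  have y: "y = coord d (param c x)" "y \<in> chart_ran d"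
    using xo by (auto simp: y_def transition_def overlap_iff[OF cd(1)] coord_in_chart_ran)
  define U' where "U' = frechet_derivative (\<lambda>y. u (param d y)) (at y)"
  have \<tau>: "(transition c d has_derivative frechet_derivative (transition c d) (at x)) (at x)"
    using C1_on_has_frechet_derivative[OF C1_on_transition[OF c d] xo] .
  moreover have "((\<lambda>y. u (param d y)) has_derivative U') (at (transition c d x))"
    unfolding U'_def y_def[symmetric] using C1_on_has_frechet_derivative[OF C1_funD[OF u d] y(2)] .
  ultimately have "((\<lambda>x. u (param d (transition c d x))) has_derivative
      (\<lambda>v. U' (frechet_derivative (transition c d) (at x) v))) (at x)"
    by (rule has_derivative_compose)
  then have "((\<lambda>x. u (param c x)) has_derivative
      (\<lambda>v. U' (frechet_derivative (transition c d) (at x) v))) (at x)"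
    by (rule has_derivative_transform_within_open[OF _ open_overlap[OF cd] xo])
      (simp add: param_transition[OF cd])
  then have "frechet_derivative (\<lambda>x. u (param c x)) (at x) (X c x)
      = U' (frechet_derivative (transition c d) (at x) (X c x))"
    by (simp add: frechet_derivative_eq)
  also have "\<dots> = U' (X d y)"
    using X c d xo jacobian_works_at[OF \<tau>] by (simp add: smooth_vector_field_def y_def)
  also have "\<dots> = deriv_along X u (param c x)"
    by (simp add: deriv_along_def U'_def y(1) Let_def flip: d_def)
  finally show ?thesis by simp
qed

text \<open>A zero of a nonnegative function is a minimum, so the differential vanishes there. Thus
  the nonzero set of the derivative of a partition function stays inside that of the function
  itself.\<close>

lemma deriv_along_eq_0:
  assumes X: "smooth_vector_field A X" and u: "C1_fun u" "\<And>p. 0 \<le> u p"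
    and p: "p \<in> topspace M" "u p = 0"
  shows "deriv_along X u p = 0"
proof -
  obtain c where c: "c \<in> A" "p \<in> chart_dom c"
    using atlas_covers p by blast
  define x where "x = coord c p"
  have x: "x \<in> chart_ran c" "param c x = p"
    using c by (auto simp: x_def coord_in_chart_ran param_coord[OF atlas_chart])
  have "frechet_derivative (\<lambda>x. u (param c x)) (at x) = (\<lambda>v. 0)"
    by (rule differential_zero_maxmin[OF x(1) open_chart_ran[OF atlas_chart[OF c(1)]]
          C1_on_has_frechet_derivative[OF C1_funD[OF u(1) c(1)] x(1)]])
      (simp add: x p u)
  then show ?thesis
    using deriv_along_param[OF X u(1) c(1) x(1)] by (simp add: x)
qed

text \<open>In a chart the sum is constant on the open coordinate range, so its differential is 0.
  Applied to a partition of unity, this is \<open>X 1 = 0\<close>.\<close>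

lemma deriv_along_sum_eq_0:
  assumes X: "smooth_vector_field A X" and u: "\<And>i. i \<in> I \<Longrightarrow> C1_fun (u i)"
    and const: "\<And>p. p \<in> topspace M \<Longrightarrow> (\<Sum>i\<in>I. u i p) = a" and p: "p \<in> topspace M"
  shows "(\<Sum>i\<in>I. deriv_along X (u i) p) = 0"
proof -
  obtain c where c: "c \<in> A" "p \<in> chart_dom c"
    using atlas_covers p by blast
  define x where "x = coord c p"
  have x: "x \<in> chart_ran c" "param c x = p"
    using c by (auto simp: x_def coord_in_chart_ran param_coord[OF atlas_chart])
  have "((\<lambda>x. \<Sum>i\<in>I. u i (param c x)) has_derivative
      (\<lambda>v. \<Sum>i\<in>I. frechet_derivative (\<lambda>x. u i (param c x)) (at x) v)) (at x)"
    by (intro has_derivative_sum C1_on_has_frechet_derivative[OF C1_funD[OF u c(1)] x(1)])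
  moreover have "((\<lambda>x. \<Sum>i\<in>I. u i (param c x)) has_derivative (\<lambda>v. 0)) (at x)"
    by (rule has_derivative_transform_within_open[OF has_derivative_const[of a]
          open_chart_ran[OF atlas_chart[OF c(1)]] x(1)])
      (simp add: const param_in_topspace c)
  ultimately have "(\<lambda>v. \<Sum>i\<in>I. frechet_derivative (\<lambda>x. u i (param c x)) (at x) v) = (\<lambda>v. 0)"
    by (rule has_derivative_unique)
  then have "(\<Sum>i\<in>I. frechet_derivative (\<lambda>x. u i (param c x)) (at x) (X c x)) = 0"
    by (rule fun_cong)
  then show ?thesis
    using deriv_along_param[OF X u c(1) x(1)] by (simp add: x)
qed

text \<open>The classical formula \<open>div X = (1 / sqrt (det g)) * (\<Sum>i. \<partial>\<^sub>i
  (sqrt (det g) * X\<^sup>i))\<close>, cleared of its denominator and stated as a relation between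
  \<open>X\<close> and a function on points.\<close>

definition has_divergence :: "('a, 'n) vfield \<Rightarrow> ('a \<Rightarrow> real) \<Rightarrow> bool"
  where "has_divergence X f \<longleftrightarrow> (\<forall>c\<in>A. \<forall>x\<in>chart_ran c.
    (\<Sum>i\<in>UNIV. frechet_derivative (\<lambda>y. vol c y * X c y $ i) (at x) (axis i 1)) = f (param c x) * vol c x)"

lemma C1_on_vfield: "smooth_vector_field A X \<Longrightarrow> c \<in> A \<Longrightarrow> C1_on (chart_ran c) (X c)"
  by (simp add: smooth_vector_field_def smooth_on_imp_C1_on)

lemma continuous_on_deriv_along:
  assumes X: "smooth_vector_field A X" and u: "C1_fun u" and c: "c \<in> A"
  shows "continuous_on (chart_ran c) (\<lambda>x. deriv_along X u (param c x) * vol c x)"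
proof (rule continuous_on_mult)
  have "continuous_on (chart_ran c) (\<lambda>x. frechet_derivative (\<lambda>x. u (param c x)) (at x) (X c x))"
    by (intro continuous_on_frechet_derivative C1_funD u c C1_on_imp_continuous_on C1_on_vfield X)
  then show "continuous_on (chart_ran c) (\<lambda>x. deriv_along X u (param c x))"
    by (rule continuous_on_eq) (simp add: deriv_along_param X u c)
qed (intro C1_on_imp_continuous_on C1_on_vol c)

text \<open>The defining sum is continuous because \<open>vol\<close> and \<open>X\<close> are C^1.
  For a soliton this supplies the continuity of \<open>R - \<rho>\<close>.\<close>

lemma continuous_on_divergence:
  assumes X: "smooth_vector_field A X" and f: "has_divergence X f" and c: "c \<in> A"
  shows "continuous_on (chart_ran c) (\<lambda>x. f (param c x) * vol c x)"
proof -
  have "continuous_on (chart_ran c)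
      (\<lambda>x. \<Sum>i\<in>UNIV. frechet_derivative (\<lambda>y. vol c y * X c y $ i) (at x) (axis i 1))"
    by (intro continuous_on_sum continuous_on_frechet_derivative C1_on_mult C1_on_vec_nth
        C1_on_vol C1_on_vfield X c continuous_on_const)
  then show ?thesis
    by (rule continuous_on_eq) (use f c in \<open>simp add: has_divergence_def\<close>)
qed

text \<open>In coordinates, the divergence of \<open>u X\<close> times \<open>vol\<close> is a sum
  of partial derivatives of compactly supported C^1 functions, so its integral is 0. The product
  rule splits it into the two integrands.\<close>

lemma chart_integral_divergence:
  assumes X: "smooth_vector_field A X" and f: "has_divergence X f" and c: "c \<in> A"
    and u: "C1_fun u" and C: "compact C" "C \<subseteq> chart_ran c" "\<And>x. x \<in> chart_ran c - C \<Longrightarrow> u (param c x) = 0"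
  shows "chart_integral c (\<lambda>p. u p * f p) = - chart_integral c (deriv_along X u)"
proof -
  have op: "open (chart_ran c)"
    using open_chart_ran[OF atlas_chart[OF c]] .
  define w where "w i y = vol c y * X c y $ i" for i y
  \<comment> \<open>Extension by zero makes the components functions on the whole space, where the
    integral of a derivative vanishes.\<close>
  define h where "h i x = (if x \<in> chart_ran c then u (param c x) * w i x else 0)" for i x
  have w: "C1_on (chart_ran c) (w i)" for i
    unfolding w_def by (intro C1_on_mult C1_on_vec_nth C1_on_vol C1_on_vfield X c)
  have h: "C1_on UNIV (h i)" for i
    unfolding h_def
    by (rule C1_on_extend_zero[OF _ op C(1,2)]) (auto intro!: C1_on_mult C1_funD u c w C(3))
  have h0: "h i x = 0" if "x \<notin> C" for i x
    using that C(3) by (simp add: h_def)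
  define D where "D i x = frechet_derivative (h i) (at x) (axis i 1)" for i x
  have "integrable lborel (\<lambda>x. \<Sum>i\<in>UNIV. D i x)"
    "(\<integral>x. (\<Sum>i\<in>UNIV. D i x) \<partial>lborel) = 0"
    unfolding D_def using lborel_integral_frechet_derivative_zero[OF h C(1) h0]
    by (simp_all add: Bochner_Integration.integral_sum)
  then have D0: "((\<lambda>x. \<Sum>i\<in>UNIV. D i x) has_integral 0) UNIV"
    using has_integral_integral_lborel by metis
  define E where "E x = u (param c x) * f (param c x) * vol c x
    + deriv_along X u (param c x) * vol c x" for x
  have D_in: "(\<Sum>i\<in>UNIV. D i x) = E x" if x: "x \<in> chart_ran c" for x
  proof -
    define u' where "u' = frechet_derivative (\<lambda>x. u (param c x)) (at x)"
    have u': "((\<lambda>x. u (param c x)) has_derivative u') (at x)"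
      unfolding u'_def using C1_on_has_frechet_derivative[OF C1_funD[OF u c] x] .
    have "D i x = u (param c x) * frechet_derivative (w i) (at x) (axis i 1)
        + vol c x * (X c x $ i * u' (axis i 1))" for i
    proof -
      have "((\<lambda>x. u (param c x) * w i x) has_derivative
          (\<lambda>v. u (param c x) * frechet_derivative (w i) (at x) v + u' v * w i x)) (at x)"
        by (intro has_derivative_mult u' C1_on_has_frechet_derivative[OF w x])
      then have "(h i has_derivative
          (\<lambda>v. u (param c x) * frechet_derivative (w i) (at x) v + u' v * w i x)) (at x)"
        by (rule has_derivative_transform_within_open[OF _ op x]) (simp add: h_def)
      then show ?thesis
        by (simp add: D_def frechet_derivative_eq w_def mult_ac)
    qed
    then have "(\<Sum>i\<in>UNIV. D i x) = u (param c x) * (\<Sum>i\<in>UNIV. frechet_derivative (w i) (at x) (axis i 1))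
        + vol c x * (\<Sum>i\<in>UNIV. X c x $ i *\<^sub>R u' (axis i 1))"
      by (simp add: sum.distrib sum_distrib_left)
    also have "(\<Sum>i\<in>UNIV. X c x $ i *\<^sub>R u' (axis i 1)) = u' (X c x)"
      using linear_sum_axis[OF has_derivative_linear[OF u']] .
    also have "(\<Sum>i\<in>UNIV. frechet_derivative (w i) (at x) (axis i 1)) = f (param c x) * vol c x"
      using f c x by (simp add: has_divergence_def w_def[abs_def])
    finally show ?thesis
      by (simp add: E_def deriv_along_param[OF X u c x] u'_def)
  qed
  have D_out: "(\<Sum>i\<in>UNIV. D i x) = 0" if "x \<notin> chart_ran c" for x
  proof -
    have "(h i has_derivative (\<lambda>v. 0)) (at x)" for i
      by (rule has_derivative_transform_within_open[OF has_derivative_const[of 0], where s = "- C"])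
        (use C that h0 in \<open>auto simp: compact_imp_closed open_Compl\<close>)
    from frechet_derivative_eq[OF this] show ?thesis
      by (simp add: D_def)
  qed
  have "(\<lambda>x. \<Sum>i\<in>UNIV. D i x) = (\<lambda>x. if x \<in> chart_ran c then E x else 0)"
    using D_in D_out by auto
  then have "integral (chart_ran c) E = 0"
    using D0 by (simp add: has_integral_restrict_UNIV integral_unique)
  \<comment> \<open>Splitting the integral of \<open>E\<close> requires each summand to be
    integrable by itself; both are continuous and vanish off \<open>C\<close>.\<close>
  moreover have "(\<lambda>x. u (param c x) * f (param c x) * vol c x) absolutely_integrable_on chart_ran c"
  proof (rule continuous_compact_support_absolutely_integrable[OF _ C(1,2)])
    have "continuous_on (chart_ran c) (\<lambda>x. u (param c x) * (f (param c x) * vol c x))"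
      by (intro continuous_on_mult continuous_on_divergence[OF X f c] C1_on_imp_continuous_on C1_funD u c)
    then show "continuous_on (chart_ran c) (\<lambda>x. u (param c x) * f (param c x) * vol c x)"
      by (simp add: mult.assoc)
  qed (simp add: C(3))
  moreover have "(\<lambda>x. deriv_along X u (param c x) * vol c x) absolutely_integrable_on chart_ran c"
  proof (rule continuous_compact_support_absolutely_integrable[OF continuous_on_deriv_along[OF X u c] C(1,2)])
    fix x assume x: "x \<in> chart_ran c - C"
    have "((\<lambda>x. u (param c x)) has_derivative (\<lambda>v. 0)) (at x)"
      by (rule has_derivative_transform_within_open[OF has_derivative_const[of 0], where s = "chart_ran c - C"])
        (use x C op in \<open>auto simp: compact_imp_closed open_Diff\<close>)
    then show "deriv_along X u (param c x) * vol c x = 0"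
      using x by (simp add: deriv_along_param[OF X u c] frechet_derivative_eq)
  qed
  ultimately show ?thesis
    unfolding E_def[abs_def] chart_integral_def absolutely_integrable_on_def
    by (simp add: Henstock_Kurzweil_Integration.integral_add)
qed

theorem signed_divergence_eq_0:
  assumes M: "compact_space M" and X: "smooth_vector_field A X" and f: "has_divergence X f"
    and sign: "(\<forall>p\<in>topspace M. 0 \<le> f p) \<or> (\<forall>p\<in>topspace M. f p \<le> 0)" and p: "p \<in> topspace M"
  shows "f p = 0"
proof -
  obtain Q c C \<psi> where part: "partition_of_unity Q c C \<psi>"
    using exists_partition_of_unity[OF M] .
  have Q: "finite Q" and cA: "\<And>p. p \<in> Q \<Longrightarrow> c p \<in> A"
    and C: "\<And>p. p \<in> Q \<Longrightarrow> compact (C p)" "\<And>p. p \<in> Q \<Longrightarrow> C p \<subseteq> chart_ran (c p)"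
    and C1: "\<And>p. p \<in> Q \<Longrightarrow> C1_fun (\<psi> p)" and nn: "\<And>p q. p \<in> Q \<Longrightarrow> 0 \<le> \<psi> p q"
    and supp: "\<And>p q. p \<in> Q \<Longrightarrow> \<psi> p q \<noteq> 0 \<Longrightarrow> q \<in> param (c p) ` C p"
    and one: "\<And>q. q \<in> topspace M \<Longrightarrow> (\<Sum>p\<in>Q. \<psi> p q) = 1"
    using part unfolding partition_of_unity_def by auto
  define D where "D p = deriv_along X (\<psi> p)" for p
  have supp_dom: "q \<in> chart_dom (c p)" if "p \<in> Q" "\<psi> p q \<noteq> 0" for p q
    using supp[OF that] param_image_subset[OF C(2)[OF that(1)]] by blast
  have supp_ran: "\<psi> p (param (c p) x) = 0" if px: "p \<in> Q" "x \<in> chart_ran (c p) - C p" for p x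
  proof (rule ccontr)
    assume "\<psi> p (param (c p) x) \<noteq> 0"
    then obtain y where "y \<in> C p" "param (c p) x = param (c p) y"
      using supp[OF px(1)] by blast
    then show False
      using px C(2)[OF px(1)] by (metis DiffD1 DiffD2 coord_param subsetD)
  qed
  have D0: "D p q = 0" if "p \<in> Q" "q \<in> topspace M" "\<psi> p q = 0" for p q
    unfolding D_def using that by (intro deriv_along_eq_0[OF X C1 nn])
  have sumD: "(\<Sum>p\<in>Q. D p q) = 0" if "q \<in> topspace M" for q
    unfolding D_def by (rule deriv_along_sum_eq_0[OF X C1 one that])
  have ibp: "chart_integral (c p) (\<lambda>q. \<psi> p q * f q) = - chart_integral (c p) (D p)" if "p \<in> Q" for p
    unfolding D_def using that
    by (intro chart_integral_divergence[OF X f cA C1 C(1) C(2) supp_ran])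
  have int: "chart_integrable (c p) (\<lambda>q. \<psi> r q * D p q)" if pr: "p \<in> Q" "r \<in> Q" for p r
    unfolding chart_integrable_def
  proof (rule continuous_compact_support_absolutely_integrable[OF _ C(1)[OF pr(1)] C(2)[OF pr(1)]])
    have "continuous_on (chart_ran (c p)) (\<lambda>x. \<psi> r (param (c p) x) * (D p (param (c p) x) * vol (c p) x))"
      unfolding D_def
      by (intro continuous_on_mult continuous_on_deriv_along X C1 cA pr C1_on_imp_continuous_on C1_funD)
    then show "continuous_on (chart_ran (c p)) (\<lambda>x. \<psi> r (param (c p) x) * D p (param (c p) x) * vol (c p) x)"
      by (simp add: mult.assoc)
    \<comment> \<open>Off \<open>C p\<close> the function \<open>\<psi> p\<close> is 0, hence so is
      its derivative \<open>D p\<close>.\<close>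
    show "\<psi> r (param (c p) x) * D p (param (c p) x) * vol (c p) x = 0" if "x \<in> chart_ran (c p) - C p" for x
      using that D0[OF pr(1) param_in_topspace[OF cA[OF pr(1)]] supp_ran[OF pr(1)]] by simp
  qed
  have change: "chart_integrable (c r) (\<lambda>q. \<psi> r q * D p q)"
    "chart_integral (c r) (\<lambda>q. \<psi> r q * D p q) = chart_integral (c p) (\<lambda>q. \<psi> r q * D p q)"
    if pr: "p \<in> Q" "r \<in> Q" for p r
  proof -
    \<comment> \<open>A nonzero \<open>\<psi> r q\<close> puts \<open>q\<close> in the chart of
      \<open>r\<close>; a nonzero \<open>D p q\<close> forces \<open>\<psi> p q\<close> to be
      nonzero and so puts \<open>q\<close> in the chart of \<open>p\<close>.\<close>
    have "{q. \<psi> r q * D p q \<noteq> 0} \<subseteq> chart_dom (c r) \<inter> chart_dom (c p)"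
    proof safe
      fix q assume q: "\<psi> r q * D p q \<noteq> 0"
      then show qr: "q \<in> chart_dom (c r)"
        using supp_dom pr by auto
      then have "q \<in> topspace M"
        using cA[OF pr(2)] atlas_chart chart_dom_subset by blast
      then show "q \<in> chart_dom (c p)"
        using q D0[OF pr(1)] supp_dom[OF pr(1)] by fastforce
    qed
    from chart_integral_change[OF cA[OF pr(2)] cA[OF pr(1)] this int[OF pr]]
    show "chart_integrable (c r) (\<lambda>q. \<psi> r q * D p q)"
      "chart_integral (c r) (\<lambda>q. \<psi> r q * D p q) = chart_integral (c p) (\<lambda>q. \<psi> r q * D p q)" .
  qed
  have cong: "chart_integral (c p) u = chart_integral (c p) v"
    if "p \<in> Q" "\<And>q. q \<in> topspace M \<Longrightarrow> u q = v q" for p u v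
    unfolding chart_integral_def using that by (intro integral_cong) (simp add: param_in_topspace cA)
  \<comment> \<open>Each \<open>D p\<close> is multiplied by 1, written as the sum of all
    \<open>\<psi> r\<close>, so that every piece can change charts.\<close>
  have "(\<Sum>p\<in>Q. chart_integral (c p) (D p)) = (\<Sum>p\<in>Q. chart_integral (c p) (\<lambda>q. \<Sum>r\<in>Q. \<psi> r q * D p q))"
    by (intro sum.cong cong) (simp_all add: one flip: sum_distrib_right)
  also have "\<dots> = (\<Sum>p\<in>Q. \<Sum>r\<in>Q. chart_integral (c p) (\<lambda>q. \<psi> r q * D p q))"
    by (intro sum.cong chart_integral_sum int) auto
  also have "\<dots> = (\<Sum>r\<in>Q. \<Sum>p\<in>Q. chart_integral (c r) (\<lambda>q. \<psi> r q * D p q))"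
    by (subst sum.swap) (simp add: change(2))
  also have "\<dots> = (\<Sum>r\<in>Q. chart_integral (c r) (\<lambda>q. \<Sum>p\<in>Q. \<psi> r q * D p q))"
    by (intro sum.cong chart_integral_sum[symmetric] change(1)) auto
  also have "\<dots> = (\<Sum>r\<in>Q. chart_integral (c r) (\<lambda>q. 0))"
    by (intro sum.cong cong) (simp_all add: sumD flip: sum_distrib_left)
  also have "\<dots> = 0"
    by (simp add: chart_integral_def)
  finally have sum0: "(\<Sum>p\<in>Q. chart_integral (c p) (\<lambda>q. \<psi> p q * f q)) = 0"
    by (simp add: ibp sum_negf)
  \<comment> \<open>\<open>s\<close> is 1 or -1 and merges the two sign cases.\<close>
  obtain s :: real where s: "s \<noteq> 0" "\<And>p. p \<in> topspace M \<Longrightarrow> 0 \<le> s * f p"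
    using sign by (metis mult_1 mult_minus1 neg_0_le_iff_le zero_neq_neg_one zero_neq_one)
  define F where "F p x = \<psi> p (param (c p) x) * f (param (c p) x) * vol (c p) x" for p x
  have Fnn: "0 \<le> s * F p x" if px: "p \<in> Q" "x \<in> chart_ran (c p)" for p x
  proof -
    have "0 \<le> \<psi> p (param (c p) x) * (s * f (param (c p) x)) * vol (c p) x"
      using nn[OF px(1)] s(2)[OF param_in_topspace[OF cA[OF px(1)] px(2)]] vol_pos[OF cA[OF px(1)] px(2)]
      by simp
    then show ?thesis
      by (simp add: F_def mult_ac)
  qed
  have F_cont: "continuous_on (chart_ran (c p)) (F p)" if p: "p \<in> Q" for p
    unfolding F_def mult.assoc
    by (intro continuous_on_mult continuous_on_divergence[OF X f] C1 cA p C1_on_imp_continuous_on C1_funD)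
  have F_int: "F p integrable_on chart_ran (c p)" if p: "p \<in> Q" for p
    using continuous_compact_support_absolutely_integrable[OF F_cont C(1) C(2), OF p p p] supp_ran[OF p]
    by (simp add: F_def absolutely_integrable_on_def)
  have "(\<Sum>p\<in>Q. integral (chart_ran (c p)) (\<lambda>x. s * F p x)) = 0"
    using sum0 by (simp add: chart_integral_def F_def flip: sum_distrib_left)
  moreover have "integral (chart_ran (c p)) (\<lambda>x. s * F p x) \<ge> 0" if "p \<in> Q" for p
    using that by (intro Henstock_Kurzweil_Integration.integral_nonneg integrable_on_mult_right F_int Fnn)
  ultimately have int0: "integral (chart_ran (c p)) (\<lambda>x. s * F p x) = 0" if "p \<in> Q" for p
    using that Q by (auto simp: sum_nonneg_eq_0_iff)
  \<comment> \<open>The vanishing integral in the chart of \<open>r\<close> determines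
    \<open>f p\<close> only where \<open>\<psi> r p\<close> is nonzero; summing over
    \<open>r\<close> then recovers \<open>f p\<close> itself.\<close>
  have zero: "\<psi> r p * f p = 0" if r: "r \<in> Q" for r
  proof (cases "\<psi> r p = 0")
    case False
    define x where "x = coord (c r) p"
    have x: "x \<in> chart_ran (c r)" "param (c r) x = p"
      using supp_dom[OF r False] cA[OF r] by (auto simp: x_def coord_in_chart_ran param_coord[OF atlas_chart])
    have "s * F r x = 0"
      by (rule integral_nonneg_continuous_eq_0D[OF open_chart_ran[OF atlas_chart[OF cA[OF r]]]
            _ _ int0[OF r] Fnn[OF r] x(1)])
        (intro continuous_on_mult continuous_on_const F_cont integrable_on_mult_right F_int r)+
    then show ?thesis
      using s(1) vol_pos[OF cA[OF r] x(1)] by (simp add: F_def x)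
  qed simp
  have "f p = (\<Sum>r\<in>Q. \<psi> r p) * f p"
    by (simp add: one p)
  also have "\<dots> = 0"
    by (simp add: sum_distrib_right zero)
  finally show ?thesis .
qed

lemma has_divergence_conformal:
  assumes X: "smooth_vector_field A X"
    and conf: "\<And>c x. c \<in> A \<Longrightarrow> x \<in> chart_ran c \<Longrightarrow>
      (1/2) *\<^sub>R lie_derivative X g c x = F (param c x) *\<^sub>R g c x"
  shows "has_divergence X (\<lambda>p. real CARD('n) * F p)"
  unfolding has_divergence_def
proof (intro ballI)
  fix c x assume c: "c \<in> A" and x: "x \<in> chart_ran c"
  have "lie_derivative X g c x $ i $ j = 2 * (F (param c x) * g c x $ i $ j)" for i j
    using arg_cong[OF conf[OF c x], of "\<lambda>H. H $ i $ j"] by simp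
  then show "(\<Sum>i\<in>UNIV. frechet_derivative (\<lambda>y. vol c y * X c y $ i) (at x) (axis i 1))
      = real CARD('n) * F (param c x) * vol c x"
    unfolding vol_def
    by (intro divergence_of_conformal_field[OF C1_on_has_frechet_derivative[OF C1_on_metric[OF c] x]
          C1_on_has_frechet_derivative[OF C1_on_vfield[OF X c] x] det_metric_pos[OF c x]])
      (simp add: lie_derivative_def)
qed

end

theorem corollary1p5:
  fixes M :: "'a topology" and A :: "('a, 'n::finite) chart set"
    and g :: "('a, 'n) tensor2" and X :: "('a, 'n) vfield" and \<rho> :: "'a \<Rightarrow> real"
  assumes "CARD('n) \<ge> 2"
    and "almost_yamabe_soliton M A g X \<rho>"
    and "compact_space M"
    and "(\<forall>p\<in>topspace M. 0 \<le> \<rho> p \<and> \<rho> p \<le> scalar_curvature A g p) \<or>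
         (\<forall>p\<in>topspace M. scalar_curvature A g p \<le> \<rho> p \<and> \<rho> p \<le> 0)"
  shows "killing_vector_field A g X"
proof -
  interpret riemannian_mfd M A g
    using assms(2) by unfold_locales (simp add: almost_yamabe_soliton_def)
  define f where "f p = scalar_curvature A g p - \<rho> p" for p
  have X: "smooth_vector_field A X"
    and conf: "\<And>c x. c \<in> A \<Longrightarrow> x \<in> chart_ran c \<Longrightarrow>
      (1/2) *\<^sub>R lie_derivative X g c x = f (param c x) *\<^sub>R g c x"
    using assms(2) by (auto simp: almost_yamabe_soliton_def f_def)
  have div: "has_divergence X (\<lambda>p. real CARD('n) * f p)"
    by (rule has_divergence_conformal[OF X conf])
  have "(\<forall>p\<in>topspace M. 0 \<le> real CARD('n) * f p) \<or> (\<forall>p\<in>topspace M. real CARD('n) * f p \<le> 0)"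
    using assms(4) by (auto simp: f_def mult_le_0_iff)
  from signed_divergence_eq_0[OF assms(3) X div this]
  have "f p = 0" if "p \<in> topspace M" for p
    using that by simp
  then show ?thesis
    unfolding killing_vector_field_def using X conf param_in_topspace by fastforce
qed

end
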